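(* Let $H\in(1/2,1)$ and let $h\in C_c^\infty(0,1)$ be real-valued with $h\ne0$. Then the Hilbert--Schmidt operator $A_h$ on $L^2(\mathbb R)$ with kernel $k_h$ (defined in the context) has infinite rank. Equivalently, the quadratic Gaussian form $D_hF=3I_2(k_h)$, the Malliavin derivative of $F=Z_1^{H,3}$ in the direction $h$, has infinite rank.
   Context: Let $B=(B(h),h\in\mathfrak H)$ be an isonormal Gaussian process over $\mathfrak H=L^2(\mathbb R)$. $I_q$ denotes the multiple Wiener--It\^o integral of order $q$ with respect to $B$, and $D$ the Malliavin derivative; for $F=I_q(f)$ with symmetric $f\in L^2(\mathbb R^q)$, $D_rF=qI_{q-1}(f(\cdot,r))$, $r\in\mathbb R$. Fix $H\in(1/2,1)$ and put $H_0=1+\frac{H-1}{3}$, $\alpha=2-2H_0=\frac{2(1-H)}3\in(0,1/3)$, $\beta=\frac{1+\alpha}{2}=\frac32-H_0\in(1/2,2/3)$. Write $x_+^{-\beta}=x^{-\beta}$ for $x>0$ and $0$ for $x\le 0$. The third-order Hermite process at time one is $F=Z_1^{H,3}=I_3(f_\alpha)$ with \[ f_\alpha(x_1,x_2,x_3)=c_H\int_0^1\prod_{j=1}^3(s-x_j)_+^{-\beta}\,ds, \] where $c_H>0$ is chosen so that $\mathbb E[F^2]=1$. For real $h\in C_c^\infty(0,1)$ put $a_h(s)=\int_0^s h(r)(s-r)^{-\beta}\,dr$, $0<s<1$, and \[ k_h(y,z)=c_H\int_0^1a_h(s)(s-y)_+^{-\beta}(s-z)_+^{-\beta}\,ds,\qquad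 y,z\in\mathbb R, \] which is a symmetric element of $L^2(\mathbb R^2)$. $A_h$ is the Hilbert--Schmidt operator on $L^2(\mathbb R)$ with kernel $k_h$. The directional Malliavin derivative is $D_hF=\langle DF,h\rangle_{L^2([0,1])}=\int_0^1 h(r)D_rF\,dr$, and one has $D_hF=3I_2(k_h)$. The rank of a quadratic Gaussian form $I_2(k)$, $k$ symmetric, is the rank of the Hilbert--Schmidt operator with kernel $k$ (i.e. the number of nonzero eigenvalues, with multiplicity, in the representation $I_2(k)\overset{\mathrm{law}}=\sum_j\lambda_j(\xi_j^2-1)$ with $\xi_j$ i.i.d. standard Gaussian). *)

theory Defs
  imports "HOL-Probability.Probability" "HOL-Library.Extended_Nat"
begin

definition L2 :: "'a measure \<Rightarrow> ('a \<Rightarrow> real) set" where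
  "L2 M = {f \<in> borel_measurable M. integrable M (\<lambda>x. (f x)\<^sup>2)}"


subsection \<open>Isonormal Gaussian processes over \<open>L\<^sup>2(\<real>)\<close>\<close>

text \<open>The degenerate law (variance zero) counts as Gaussian.\<close>

definition centered_gaussian :: "'a measure \<Rightarrow> ('a \<Rightarrow> real) \<Rightarrow> bool" where
  "centered_gaussian M X \<longleftrightarrow> X \<in> borel_measurable M \<and>
     ((AE \<omega> in M. X \<omega> = 0) \<or> (\<exists>\<sigma>>0. distributed M lborel X (normal_density 0 \<sigma>)))"

text \<open>Joint Gaussianity is expressed through finite linear combinations. Elements of
  \<open>L\<^sup>2(\<real>)\<close> are represented by functions; that \<open>B h\<close> depends, up to null events, only on
  the class of \<open>h\<close> follows from the covariance condition.\<close>

definition isonormal :: "'a measure \<Rightarrow> ((real \<Rightarrow> real) \<Rightarrow> 'a \<Rightarrow> real) \<Rightarrow> bool" where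
  "isonormal M B \<longleftrightarrow> prob_space M \<and>
     (\<forall>(n::nat) c g. (\<forall>i<n. g i \<in> L2 lborel) \<longrightarrow>
        centered_gaussian M (\<lambda>\<omega>. \<Sum>i<n. c i * B (g i) \<omega>)) \<and>
     (\<forall>g\<in>L2 lborel. \<forall>g'\<in>L2 lborel.
        (\<integral>\<omega>. B g \<omega> * B g' \<omega> \<partial>M) = (\<integral>x. g x * g' x \<partial>lborel))"


subsection \<open>Multiple Wiener--Ito integrals\<close>

text \<open>The probabilists' Hermite polynomials.\<close>

fun hermite :: "nat \<Rightarrow> real \<Rightarrow> real" where
  "hermite 0 x = 1"
| "hermite (Suc 0) x = x"
| "hermite (Suc (Suc n)) x = x * hermite (Suc n) x - real (Suc n) * hermite n x"

text \<open>\<open>\<real>\<^sup>q\<close> with Lebesgue measure, coordinates numbered from \<open>0\<close>.\<close>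

abbreviation lebesgue_power :: "nat \<Rightarrow> (nat \<Rightarrow> real) measure" where
  "lebesgue_power q \<equiv> Pi\<^sub>M {..<q} (\<lambda>_. lborel)"

definition L2_sym :: "nat \<Rightarrow> ((nat \<Rightarrow> real) \<Rightarrow> real) set" where
  "L2_sym q = {f \<in> L2 (lebesgue_power q).
     \<forall>p. p permutes {..<q} \<longrightarrow> (AE x in lebesgue_power q. f (x \<circ> p) = f x)}"

text \<open>\<open>wiener_integral M B q f X\<close> says that \<open>X\<close> is (a version of) \<open>I\<^sub>q(f)\<close>, \<open>f\<close> symmetric.
  \<open>I\<^sub>q\<close> is the continuous linear extension of \<open>g\<^sup>\<otimes>\<^sup>q \<mapsto> H\<^sub>q(B(g))\<close>, \<open>\<parallel>g\<parallel> = 1\<close>; its graph is therefore the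
  closure, in \<open>L\<^sup>2(\<real>\<^sup>q) \<times> L\<^sup>2(M)\<close>, of the linear span of the pairs \<open>(g\<^sup>\<otimes>\<^sup>q, H\<^sub>q(B(g)))\<close>.\<close>

definition wiener_integral ::
  "'a measure \<Rightarrow> ((real \<Rightarrow> real) \<Rightarrow> 'a \<Rightarrow> real) \<Rightarrow> nat \<Rightarrow> ((nat \<Rightarrow> real) \<Rightarrow> real) \<Rightarrow> ('a \<Rightarrow> real) \<Rightarrow> bool"
where
  "wiener_integral M B q f X \<longleftrightarrow> f \<in> L2_sym q \<and> X \<in> L2 M \<and>
     (\<forall>\<epsilon>>0. \<exists>(n::nat) c g.
        (\<forall>i<n. g i \<in> L2 lborel \<and> (\<integral>x. (g i x)\<^sup>2 \<partial>lborel) = 1) \<and>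
        (\<integral>x. (f x - (\<Sum>i<n. c i * (\<Prod>j<q. g i (x j))))\<^sup>2 \<partial>lebesgue_power q) < \<epsilon> \<and>
        (\<integral>\<omega>. (X \<omega> - (\<Sum>i<n. c i * hermite q (B (g i) \<omega>)))\<^sup>2 \<partial>M) < \<epsilon>)"

text \<open>A function of two real variables as a kernel on \<open>\<real>\<^sup>2\<close>.\<close>

definition kernel2 :: "(real \<Rightarrow> real \<Rightarrow> real) \<Rightarrow> (nat \<Rightarrow> real) \<Rightarrow> real" where
  "kernel2 k x = k (x 0) (x 1)"


subsection \<open>Malliavin derivative\<close>

text \<open>\<open>DF\<close> is (a jointly measurable, square-integrable version of) the Malliavin derivative of
  \<open>I\<^sub>q(f)\<close>: \<open>D\<^sub>r I\<^sub>q(f) = q I\<^bsub>q-1\<^esub>(f(\<sqdot>, r))\<close>. The update \<open>x(q - 1 := r)\<close> inserts \<open>r\<close> as last coordinate.\<close>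

definition malliavin_derivative ::
  "'a measure \<Rightarrow> ((real \<Rightarrow> real) \<Rightarrow> 'a \<Rightarrow> real) \<Rightarrow> nat \<Rightarrow> ((nat \<Rightarrow> real) \<Rightarrow> real) \<Rightarrow> (real \<Rightarrow> 'a \<Rightarrow> real) \<Rightarrow> bool"
where
  "malliavin_derivative M B q f DF \<longleftrightarrow>
     (\<lambda>(r, \<omega>). DF r \<omega>) \<in> L2 (lborel \<Otimes>\<^sub>M M) \<and>
     (AE r in lborel. \<exists>Y. wiener_integral M B (q - 1) (\<lambda>x. f (x(q - 1 := r))) Y \<and>
        (AE \<omega> in M. DF r \<omega> = real q * Y \<omega>))"

definition directional_derivative ::
  "(real \<Rightarrow> real) \<Rightarrow> (real \<Rightarrow> 'a \<Rightarrow> real) \<Rightarrow> 'a \<Rightarrow> real" where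
  "directional_derivative h DF \<omega> = (LBINT r:{0..1}. h r * DF r \<omega>)"


subsection \<open>Rank\<close>

definition kernel_operator ::
  "(real \<Rightarrow> real \<Rightarrow> real) \<Rightarrow> (real \<Rightarrow> real) \<Rightarrow> real \<Rightarrow> real" where
  "kernel_operator k g y = (\<integral>z. k y z * g z \<partial>lborel)"

text \<open>The dimension of the range of the operator on \<open>L\<^sup>2(\<real>)\<close> with kernel \<open>k\<close>: the supremum of the
  sizes of finite families in the range which are linearly independent modulo null functions.\<close>

definition kernel_rank :: "(real \<Rightarrow> real \<Rightarrow> real) \<Rightarrow> enat" where
  "kernel_rank k = Sup {enat n | n. \<exists>g. (\<forall>i<n. g i \<in> L2 lborel) \<and>
     (\<forall>c. (AE y in lborel. (\<Sum>i<n. c i * kernel_operator k (g i) y) = 0) \<longrightarrow> (\<forall>i<n. c i = 0))}"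

text \<open>The rank of a quadratic Gaussian form \<open>X = I\<^sub>2(k)\<close>. By the isometry property of \<open>I\<^sub>2\<close>, the
  symmetric kernel \<open>k\<close> is determined by \<open>X\<close> up to null sets; for \<open>X\<close> which is not of this form
  the value is meaningless.\<close>

definition quadratic_form_rank ::
  "'a measure \<Rightarrow> ((real \<Rightarrow> real) \<Rightarrow> 'a \<Rightarrow> real) \<Rightarrow> ('a \<Rightarrow> real) \<Rightarrow> enat" where
  "quadratic_form_rank M B X = kernel_rank (SOME k. wiener_integral M B 2 (kernel2 k) X)"


subsection \<open>The third-order Hermite process at time one\<close>

definition hermite_alpha :: "real \<Rightarrow> real" where
  "hermite_alpha H = (let H0 = 1 + (H - 1) / 3 in 2 - 2 * H0)"

definition hermite_beta :: "real \<Rightarrow> real" where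
  "hermite_beta H = (1 + hermite_alpha H) / 2"

text \<open>\<open>pos_power b x = x\<^sub>+\<^bsup>-b\<^esup>\<close>; the case distinction is needed because \<open>powr\<close> need not vanish at
  negative reals.\<close>

definition pos_power :: "real \<Rightarrow> real \<Rightarrow> real" where
  "pos_power b x = (if x > 0 then x powr (- b) else 0)"

text \<open>The normalising constant \<open>c = c\<^sub>H\<close> is a parameter.\<close>

definition f_kernel :: "real \<Rightarrow> real \<Rightarrow> (nat \<Rightarrow> real) \<Rightarrow> real" where
  "f_kernel H c x = c * (LBINT s:{0..1}. \<Prod>j<3. pos_power (hermite_beta H) (s - x j))"

definition a_fun :: "real \<Rightarrow> (real \<Rightarrow> real) \<Rightarrow> real \<Rightarrow> real" where
  "a_fun H h s = (LBINT r:{0<..<s}. h r * (s - r) powr (- hermite_beta H))"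

definition k_kernel :: "real \<Rightarrow> real \<Rightarrow> (real \<Rightarrow> real) \<Rightarrow> real \<Rightarrow> real \<Rightarrow> real" where
  "k_kernel H c h y z = c * (LBINT s:{0<..<1}. a_fun H h s *
     pos_power (hermite_beta H) (s - y) * pos_power (hermite_beta H) (s - z))"

text \<open>\<open>C\<^sub>c\<^sup>\<infinity>(0,1)\<close>, each function being extended by zero to \<open>\<real>\<close>.\<close>

definition test_functions :: "(real \<Rightarrow> real) set" where
  "test_functions = {h. (\<forall>n x. ((deriv ^^ n) h) differentiable (at x)) \<and>
     compact (closure {x. h x \<noteq> 0}) \<and> closure {x. h x \<noteq> 0} \<subseteq> {0<..<1}}"

end

theory Submission
  imports Defs
begin

text \<open>
  The operator. Let \<open>b\<close> be the exponent \<open>\<beta>\<close>, let \<open>T g(s) = \<integral> (s - y)\<^sub>+\<^bsup>-b\<^esup> g(y) dy\<close> be the Abel integral, and let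
  \<open>a = a\<^sub>h\<close>. Then \<open>A\<^sub>h = c T\<^sup>* M\<^sub>a T\<close> with \<open>M\<^sub>a\<close> the multiplication by \<open>a\<close> on \<open>(0, 1)\<close>, that is,
  \<open>\<langle>A\<^sub>h g, g'\<rangle> = c \<integral> a \<cdot> T g \<cdot> T g'\<close> (\<open>abel_form\<close>). By the Beta integral, \<open>T\<close> maps \<open>(y - p)\<^sub>+\<^bsup>b\<^esup>\<close> to a
  positive multiple of \<open>(s - p)\<^sub>+\<close>, and hence second differences of \<open>y\<^sub>+\<^bsup>b\<^esup>\<close> to tent functions
  (\<open>abel_probe\<close>). The same formula, reflected, shows that \<open>a\<close> is not identically zero: its integrals
  against reflected second differences are multiples of integrals of \<open>h\<close> against tents
  (\<open>abel_transform_nonzero\<close>). As \<open>a\<close> is continuous, it has constant sign on some interval. For each \<open>n\<close>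
  that interval carries \<open>n\<close> tents which do not overlap; on their preimages under \<open>T\<close> the bilinear form of
  \<open>A\<^sub>h\<close> is diagonal with nonzero diagonal, so that the range of \<open>A\<^sub>h\<close> has dimension at least \<open>n\<close>
  (\<open>abel_kernel_rank\<close>).

  The directional derivative. By Fubini, \<open>k\<^sub>h = \<integral> h(r) f(\<sqdot>, r) dr\<close> outside the diagonal
  (\<open>f_kernel_mean\<close>), and \<open>D\<^sub>hF = \<integral> h(r) D\<^sub>rF dr\<close> with \<open>D\<^sub>rF = 3 I\<^sub>2(f(\<sqdot>, r))\<close>. What has to be shown is that
  \<open>I\<^sub>2\<close> commutes with the integral over \<open>r\<close>. Its graph is a closed linear subspace, and a closed subspace
  contains the averages of its elements; the averages are approximated by finite sums
  whose sample points are selected one by one so that the squared error stays of the order of the number of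
  points (\<open>wiener_integral_mean\<close>).

  The rank of the quadratic form. The fourth moments of Gaussian variables give
  \<open>E (I\<^sub>2 k)\<^sup>2 = 2 \<parallel>k\<parallel>\<^sup>2\<close>, first on the span of the elementary tensors and then on its closure. Therefore a
  quadratic form determines its kernel almost everywhere (\<open>second_chaos_kernel_unique\<close>), and with it
  the range of the operator.
\<close>

section \<open>Square-integrable functions\<close>

lemma L2_measurable [measurable_dest]: "f \<in> L2 M \<Longrightarrow> f \<in> borel_measurable M"
  and L2_integrable: "f \<in> L2 M \<Longrightarrow> integrable M (\<lambda>x. (f x)\<^sup>2)"
  by (auto simp: L2_def)

lemma L2_I: "f \<in> borel_measurable M \<Longrightarrow> integrable M (\<lambda>x. (f x)\<^sup>2) \<Longrightarrow> f \<in> L2 M"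
  by (auto simp: L2_def)

lemma L2_cong_AE:
  assumes "f \<in> L2 M" "g \<in> borel_measurable M" "AE x in M. f x = g x"
  shows "g \<in> L2 M"
proof (rule L2_I)
  have "integrable M (\<lambda>x. (f x)\<^sup>2) = integrable M (\<lambda>x. (g x)\<^sup>2)"
    using assms by (intro integrable_cong_AE) (auto simp: L2_def)
  with assms show "integrable M (\<lambda>x. (g x)\<^sup>2)" by (simp add: L2_integrable)
qed fact

lemma L2_mult_integrable:
  assumes "f \<in> L2 M" "g \<in> L2 M"
  shows "integrable M (\<lambda>x. f x * g x)"
proof (rule Bochner_Integration.integrable_bound)
  show "integrable M (\<lambda>x. (f x)\<^sup>2 + (g x)\<^sup>2)"
    using assms by (intro Bochner_Integration.integrable_add L2_integrable)
  show "(\<lambda>x. f x * g x) \<in> borel_measurable M"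
    using assms by (auto simp: L2_def)
  have "\<bar>a * b\<bar> \<le> a\<^sup>2 + b\<^sup>2" for a b :: real
    using sum_squares_bound[of "\<bar>a\<bar>" "\<bar>b\<bar>"] mult_nonneg_nonneg[OF abs_ge_zero[of a] abs_ge_zero[of b]]
    unfolding abs_mult power2_abs by linarith
  then show "AE x in M. norm (f x * g x) \<le> norm ((f x)\<^sup>2 + (g x)\<^sup>2)"
    by simp
qed

lemma L2_add:
  assumes "f \<in> L2 M" "g \<in> L2 M"
  shows "(\<lambda>x. f x + g x) \<in> L2 M"
proof (rule L2_I)
  have "integrable M (\<lambda>x. (f x)\<^sup>2 + (g x)\<^sup>2 + 2 * (f x * g x))"
    using assms by (intro Bochner_Integration.integrable_add L2_integrable integrable_mult_right L2_mult_integrable)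
  then show "integrable M (\<lambda>x. (f x + g x)\<^sup>2)"
    by (simp add: power2_sum algebra_simps)
qed (use assms in \<open>auto simp: L2_def\<close>)

lemma L2_cmult: "f \<in> L2 M \<Longrightarrow> (\<lambda>x. a * f x) \<in> L2 M" for a :: real
  by (auto simp: L2_def power_mult_distrib)

lemma L2_diff: "f \<in> L2 M \<Longrightarrow> g \<in> L2 M \<Longrightarrow> (\<lambda>x. f x - g x) \<in> L2 M"
  using L2_add[of f M "\<lambda>x. (-1) * g x"] L2_cmult[of g M "-1"] by simp

lemma L2_zero: "(\<lambda>x. 0) \<in> L2 M"
  by (auto simp: L2_def)

lemma L2_sum: "(\<And>i. i \<in> I \<Longrightarrow> f i \<in> L2 M) \<Longrightarrow> (\<lambda>x. \<Sum>i\<in>I. f i x) \<in> L2 M"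
  by (induction I rule: infinite_finite_induct) (auto intro: L2_add L2_zero)

text \<open>The triangle inequality, squared; the factor two comes from \<open>(a + b)\<^sup>2 \<le> 2 a\<^sup>2 + 2 b\<^sup>2\<close>.\<close>

lemma L2_dist_triangle:
  assumes "f \<in> L2 M" "g \<in> L2 M" "k \<in> L2 M"
  shows "(\<integral>x. (f x - k x)\<^sup>2 \<partial>M) \<le> 2 * (\<integral>x. (f x - g x)\<^sup>2 \<partial>M) + 2 * (\<integral>x. (g x - k x)\<^sup>2 \<partial>M)"
proof -
  note [simp] = L2_integrable[OF L2_diff[OF assms(1,2)]] L2_integrable[OF L2_diff[OF assms(2,3)]]
  have "(\<integral>x. (f x - k x)\<^sup>2 \<partial>M) \<le> (\<integral>x. 2 * (f x - g x)\<^sup>2 + 2 * (g x - k x)\<^sup>2 \<partial>M)"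
  proof (rule integral_mono)
    have "(a + b)\<^sup>2 \<le> 2 * a\<^sup>2 + 2 * b\<^sup>2" for a b :: real
      using sum_squares_bound[of a b] by (simp add: power2_sum)
    from this[of "f x - g x" "g x - k x" for x]
    show "(f x - k x)\<^sup>2 \<le> 2 * (f x - g x)\<^sup>2 + 2 * (g x - k x)\<^sup>2" for x by simp
  qed (use assms in \<open>auto intro!: L2_integrable L2_diff\<close>)
  then show ?thesis by simp
qed

lemma L2_cmult_dist:
  "(\<integral>x. (a * f x - a * g x)\<^sup>2 \<partial>M) = a\<^sup>2 * (\<integral>x. (f x - g x)\<^sup>2 \<partial>M)" for a :: real
  by (simp add: right_diff_distrib[symmetric] power_mult_distrib)

lemma nn_integral_sq_diff:
  assumes "f \<in> L2 M" "g \<in> L2 M"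
  shows "(\<integral>\<^sup>+x. ennreal ((f x - g x)\<^sup>2) \<partial>M) = ennreal (\<integral>x. (f x - g x)\<^sup>2 \<partial>M)"
  by (intro nn_integral_eq_integral L2_integrable L2_diff assms) simp


section \<open>Gaussian moments\<close>

lemma isonormal_gaussian:
  assumes "isonormal M B" "finite I" "\<And>i. i \<in> I \<Longrightarrow> g i \<in> L2 lborel"
  shows "centered_gaussian M (\<lambda>\<omega>. \<Sum>i\<in>I. c i * B (g i) \<omega>)"
proof -
  obtain e where e: "bij_betw e {..<card I} I"
    using ex_bij_betw_nat_finite[OF assms(2)] by (auto simp: atLeast0LessThan)
  have *: "(\<And>i. i < n \<Longrightarrow> g i \<in> L2 lborel) \<Longrightarrow> centered_gaussian M (\<lambda>\<omega>. \<Sum>i<n. c i * B (g i) \<omega>)"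
    for n :: nat and g c
    using assms(1) unfolding isonormal_def by blast
  have "(\<forall>i<card I. g (e i) \<in> L2 lborel) \<longrightarrow>
        centered_gaussian M (\<lambda>\<omega>. \<Sum>i<card I. c (e i) * B (g (e i)) \<omega>)"
    using *[of "card I" "\<lambda>i. g (e i)" "\<lambda>i. c (e i)"] by simp
  moreover have "(\<Sum>i<card I. c (e i) * B (g (e i)) \<omega>) = (\<Sum>i\<in>I. c i * B (g i) \<omega>)" for \<omega>
    by (rule sum.reindex_bij_betw[OF e])
  moreover have "\<forall>i<card I. g (e i) \<in> L2 lborel"
    using assms(3) e by (auto simp: bij_betw_def)
  ultimately show ?thesis by simp
qed

lemma isonormal_gaussian1:
  assumes "isonormal M B" "g \<in> L2 lborel"
  shows "centered_gaussian M (B g)"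
  using isonormal_gaussian[OF assms(1), of "{()}" "\<lambda>_. g" "\<lambda>_. 1"] assms(2) by simp

lemma isonormal_gaussian2:
  assumes "isonormal M B" "g \<in> L2 lborel" "g' \<in> L2 lborel"
  shows "centered_gaussian M (\<lambda>\<omega>. B g \<omega> + a * B g' \<omega>)"
  using isonormal_gaussian[OF assms(1), of "{True,False}" "\<lambda>b. if b then g else g'" "\<lambda>b. if b then 1 else a"]
    assms(2,3) by simp

lemma centered_gaussian_moments:
  assumes "centered_gaussian M X"
  shows centered_gaussian_integrable: "prob_space M \<Longrightarrow> integrable M (\<lambda>\<omega>. X \<omega> ^ k)"
    and centered_gaussian_fourth: "(\<integral>\<omega>. X \<omega> ^ 4 \<partial>M) = 3 * (\<integral>\<omega>. (X \<omega>)\<^sup>2 \<partial>M)\<^sup>2"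
proof -
  have X [measurable]: "X \<in> borel_measurable M"
    using assms by (simp add: centered_gaussian_def)
  consider "AE \<omega> in M. X \<omega> = 0"
    | \<sigma> where "\<sigma> > 0" "distributed M lborel X (normal_density 0 \<sigma>)"
    using assms by (auto simp: centered_gaussian_def)
  then have "(prob_space M \<longrightarrow> integrable M (\<lambda>\<omega>. X \<omega> ^ k)) \<and>
      (\<integral>\<omega>. X \<omega> ^ 4 \<partial>M) = 3 * (\<integral>\<omega>. (X \<omega>)\<^sup>2 \<partial>M)\<^sup>2"
  proof cases
    case 1
    have "integrable M (\<lambda>\<omega>. X \<omega> ^ k)" if "prob_space M"
    proof -
      interpret prob_space M by fact
      show ?thesis
        by (rule integrable_const_bound[where B="0 ^ k"]) (use 1 in auto)
    qed
    moreover have "(\<integral>\<omega>. X \<omega> ^ 4 \<partial>M) = 0" "(\<integral>\<omega>. (X \<omega>)\<^sup>2 \<partial>M) = 0"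
      using 1 by (auto intro!: integral_eq_zero_AE)
    ultimately show ?thesis by simp
  next
    case 2
    have "integrable M (\<lambda>\<omega>. X \<omega> ^ k)"
      using integrable_normal_moment[OF 2(1), of 0 k]
        distributed_integrable[OF 2(2), of "\<lambda>x. x ^ k"] by simp
    moreover have "(\<integral>\<omega>. X \<omega> ^ (2*j) \<partial>M) = fact (2 * j) / ((2 / \<sigma>\<^sup>2)^j * fact j)" for j
      using integral_normal_moment_even[OF 2(1), of 0 j]
        distributed_integral[OF 2(2), of "\<lambda>x. x ^ (2*j)"] by simp
    from this[of 1] this[of 2] have "(\<integral>\<omega>. X \<omega> ^ 2 \<partial>M) = \<sigma>\<^sup>2" "(\<integral>\<omega>. X \<omega> ^ 4 \<partial>M) = 3 * (\<sigma>\<^sup>2)\<^sup>2"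
      using 2(1) by (simp_all add: fact_numeral field_simps power2_eq_square power4_eq_xxxx)
    ultimately show ?thesis by simp
  qed
  then show "prob_space M \<Longrightarrow> integrable M (\<lambda>\<omega>. X \<omega> ^ k)"
    "(\<integral>\<omega>. X \<omega> ^ 4 \<partial>M) = 3 * (\<integral>\<omega>. (X \<omega>)\<^sup>2 \<partial>M)\<^sup>2" by auto
qed

text \<open>Polynomials in a Gaussian variable have moments of all orders; hence the variables that span the
  chaos of order \<open>q\<close> are square-integrable.\<close>

lemma hermite_polynomial: "\<exists>p. \<forall>x. hermite q x = poly p x"
proof (induction q rule: less_induct)
  case (less q)
  consider "q = 0" | "q = Suc 0" | n where "q = Suc (Suc n)"
    by (metis not0_implies_Suc)
  then show ?case
  proof cases
    case 1
    then show ?thesis by (intro exI[of _ 1]) simp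
  next
    case 2
    then show ?thesis by (intro exI[of _ "[:0, 1:]"]) simp
  next
    case 3
    obtain p p' where "\<forall>x. hermite (Suc n) x = poly p x" "\<forall>x. hermite n x = poly p' x"
      using less[of n] less[of "Suc n"] 3 by auto
    then show ?thesis
      by (intro exI[of _ "[:0, 1:] * p - smult (real (Suc n)) p'"]) (simp add: 3)
  qed
qed

lemma hermite_L2:
  assumes "isonormal M B" "g \<in> L2 lborel"
  shows "(\<lambda>\<omega>. hermite q (B g \<omega>)) \<in> L2 M"
proof -
  obtain p where p: "\<And>x. hermite q x = poly p x" using hermite_polynomial[of q] by blast
  have "centered_gaussian M (B g)" "prob_space M"
    using isonormal_gaussian1[OF assms] assms(1) by (simp_all add: isonormal_def)
  note int = centered_gaussian_integrable[OF this]
  have [measurable]: "B g \<in> borel_measurable M"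
    using \<open>centered_gaussian M (B g)\<close> by (simp add: centered_gaussian_def)
  have "integrable M (\<lambda>\<omega>. \<Sum>i\<le>degree (p ^ 2). coeff (p ^ 2) i * B g \<omega> ^ i)"
    by (intro Bochner_Integration.integrable_sum integrable_mult_right int)
  moreover have "(\<Sum>i\<le>degree (p ^ 2). coeff (p ^ 2) i * B g \<omega> ^ i) = (hermite q (B g \<omega>))\<^sup>2" for \<omega>
    by (simp only: poly_altdef[symmetric] p poly_power)
  moreover have "(\<lambda>\<omega>. \<Sum>i\<le>degree p. coeff p i * B g \<omega> ^ i) \<in> borel_measurable M"
    by measurable
  then have "(\<lambda>\<omega>. hermite q (B g \<omega>)) \<in> borel_measurable M"
    by (simp only: poly_altdef[symmetric] p)
  ultimately show ?thesis
    by (intro L2_I) simp_all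
qed


section \<open>The graph of the multiple Wiener--Ito integral\<close>

lemma L2_dist_add:
  assumes "f \<in> L2 M" "g \<in> L2 M" "f' \<in> L2 M" "g' \<in> L2 M"
  shows "(\<integral>x. (f x + f' x - (g x + g' x))\<^sup>2 \<partial>M)
    \<le> 2 * (\<integral>x. (f x - g x)\<^sup>2 \<partial>M) + 2 * (\<integral>x. (f' x - g' x)\<^sup>2 \<partial>M)"
  using L2_dist_triangle[OF L2_add[OF assms(1,3)] L2_add[OF assms(2,3)] L2_add[OF assms(2,4)]]
  by simp

text \<open>The span whose closure is the graph of \<open>I\<^sub>q\<close>.\<close>

definition chaos_pair ::
  "((real \<Rightarrow> real) \<Rightarrow> 'a \<Rightarrow> real) \<Rightarrow> nat \<Rightarrow> ((nat \<Rightarrow> real) \<Rightarrow> real) \<Rightarrow> ('a \<Rightarrow> real) \<Rightarrow> bool" where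
  "chaos_pair B q u S \<longleftrightarrow> (\<exists>(n::nat) c g.
     (\<forall>i<n. g i \<in> L2 lborel \<and> (\<integral>x. (g i x)\<^sup>2 \<partial>lborel) = 1) \<and>
     u = (\<lambda>x. \<Sum>i<n. c i * (\<Prod>j<q. g i (x j))) \<and>
     S = (\<lambda>\<omega>. \<Sum>i<n. c i * hermite q (B (g i) \<omega>)))"

lemma chaos_pair_sum:
  assumes "finite I" "\<And>i. i \<in> I \<Longrightarrow> g i \<in> L2 lborel \<and> (\<integral>x. (g i x)\<^sup>2 \<partial>lborel) = 1"
  shows "chaos_pair B q (\<lambda>x. \<Sum>i\<in>I. c i * (\<Prod>j<q. g i (x j))) (\<lambda>\<omega>. \<Sum>i\<in>I. c i * hermite q (B (g i) \<omega>))"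
proof -
  obtain e where e: "bij_betw e {..<card I} I"
    using ex_bij_betw_nat_finite[OF assms(1)] by (auto simp: atLeast0LessThan)
  have "(\<Sum>i<card I. c (e i) * (\<Prod>j<q. g (e i) (x j))) = (\<Sum>i\<in>I. c i * (\<Prod>j<q. g i (x j)))"
    "(\<Sum>i<card I. c (e i) * hermite q (B (g (e i)) \<omega>)) = (\<Sum>i\<in>I. c i * hermite q (B (g i) \<omega>))" for x \<omega>
    by (rule sum.reindex_bij_betw[OF e])+
  moreover have "\<forall>i<card I. g (e i) \<in> L2 lborel \<and> (\<integral>x. (g (e i) x)\<^sup>2 \<partial>lborel) = 1"
    using assms(2) e by (auto simp: bij_betw_def)
  ultimately show ?thesis
    unfolding chaos_pair_def
    by (intro exI[of _ "card I"] exI[of _ "\<lambda>i. c (e i)"] exI[of _ "\<lambda>i. g (e i)"]) simp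
qed

lemma chaos_pair_add:
  assumes "chaos_pair B q u S" "chaos_pair B q u' S'"
  shows "chaos_pair B q (\<lambda>x. u x + u' x) (\<lambda>\<omega>. S \<omega> + S' \<omega>)"
proof -
  obtain n :: nat and c g where 1: "\<And>i. i < n \<Longrightarrow> g i \<in> L2 lborel \<and> (\<integral>x. (g i x)\<^sup>2 \<partial>lborel) = 1"
    "u = (\<lambda>x. \<Sum>i<n. c i * (\<Prod>j<q. g i (x j)))" "S = (\<lambda>\<omega>. \<Sum>i<n. c i * hermite q (B (g i) \<omega>))"
    using assms(1) unfolding chaos_pair_def by blast
  obtain m :: nat and d k where 2: "\<And>i. i < m \<Longrightarrow> k i \<in> L2 lborel \<and> (\<integral>x. (k i x)\<^sup>2 \<partial>lborel) = 1"
    "u' = (\<lambda>x. \<Sum>i<m. d i * (\<Prod>j<q. k i (x j)))" "S' = (\<lambda>\<omega>. \<Sum>i<m. d i * hermite q (B (k i) \<omega>))"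
    using assms(2) unfolding chaos_pair_def by blast
  have "chaos_pair B q
      (\<lambda>x. \<Sum>i\<in>{..<n} <+> {..<m}. case_sum c d i * (\<Prod>j<q. case_sum g k i (x j)))
      (\<lambda>\<omega>. \<Sum>i\<in>{..<n} <+> {..<m}. case_sum c d i * hermite q (B (case_sum g k i) \<omega>))"
    by (rule chaos_pair_sum) (use 1 2 in \<open>auto split: sum.split\<close>)
  then show ?thesis
    by (simp add: sum.Plus 1 2)
qed

lemma chaos_pair_cmult:
  assumes "chaos_pair B q u S"
  shows "chaos_pair B q (\<lambda>x. a * u x) (\<lambda>\<omega>. a * S \<omega>)"
proof -
  obtain n :: nat and c g where 1: "\<And>i. i < n \<Longrightarrow> g i \<in> L2 lborel \<and> (\<integral>x. (g i x)\<^sup>2 \<partial>lborel) = 1"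
    "u = (\<lambda>x. \<Sum>i<n. c i * (\<Prod>j<q. g i (x j)))" "S = (\<lambda>\<omega>. \<Sum>i<n. c i * hermite q (B (g i) \<omega>))"
    using assms(1) unfolding chaos_pair_def by blast
  have "chaos_pair B q (\<lambda>x. \<Sum>i<n. (a * c i) * (\<Prod>j<q. g i (x j))) (\<lambda>\<omega>. \<Sum>i<n. (a * c i) * hermite q (B (g i) \<omega>))"
    by (rule chaos_pair_sum) (use 1 in auto)
  then show ?thesis
    by (simp add: 1 sum_distrib_left mult.assoc)
qed

interpretation lborel_power: product_sigma_finite "\<lambda>_::nat. lborel :: real measure"
  by standard

lemma tensor_power_L2:
  assumes "g \<in> L2 lborel"
  shows "(\<lambda>x. \<Prod>j<q. g (x j)) \<in> L2 (lebesgue_power q)"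
proof (rule L2_I)
  have [measurable]: "g \<in> borel_measurable lborel" using assms by (rule L2_measurable)
  show "(\<lambda>x. \<Prod>j<q. g (x j)) \<in> borel_measurable (lebesgue_power q)"
    by measurable
  have "integrable (lebesgue_power q) (\<lambda>x. \<Prod>j<q. (g (x j))\<^sup>2)"
    by (rule lborel_power.product_integrable_prod) (use L2_integrable[OF assms] in auto)
  then show "integrable (lebesgue_power q) (\<lambda>x. (\<Prod>j<q. g (x j))\<^sup>2)"
    by (simp add: prod_power_distrib)
qed

lemma tensor_power_inner:
  assumes "g \<in> L2 lborel" "g' \<in> L2 lborel"
  shows "(\<integral>x. (\<Prod>j<q. g (x j)) * (\<Prod>j<q. g' (x j)) \<partial>lebesgue_power q) = (\<integral>x. g x * g' x \<partial>lborel) ^ q"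
proof -
  have "(\<integral>x. (\<Prod>j<q. g (x j) * g' (x j)) \<partial>lebesgue_power q) = (\<Prod>j<q. \<integral>x. g x * g' x \<partial>lborel)"
    by (rule lborel_power.product_integral_prod) (use L2_mult_integrable[OF assms] in auto)
  then show ?thesis
    by (simp add: prod.distrib)
qed

lemma chaos_pair_L2:
  assumes "isonormal M B" "chaos_pair B q u S"
  shows "u \<in> L2 (lebesgue_power q)" "S \<in> L2 M"
proof -
  obtain n :: nat and c g where 1: "\<And>i. i < n \<Longrightarrow> g i \<in> L2 lborel \<and> (\<integral>x. (g i x)\<^sup>2 \<partial>lborel) = 1"
    "u = (\<lambda>x. \<Sum>i<n. c i * (\<Prod>j<q. g i (x j)))" "S = (\<lambda>\<omega>. \<Sum>i<n. c i * hermite q (B (g i) \<omega>))"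
    using assms(2) unfolding chaos_pair_def by blast
  show "u \<in> L2 (lebesgue_power q)"
    unfolding 1 by (intro L2_sum L2_cmult tensor_power_L2) (use 1 in auto)
  show "S \<in> L2 M"
    unfolding 1 by (intro L2_sum L2_cmult hermite_L2[OF assms(1)]) (use 1 in auto)
qed

lemma wiener_integral_iff:
  "wiener_integral M B q f X \<longleftrightarrow> f \<in> L2_sym q \<and> X \<in> L2 M \<and>
    (\<forall>\<epsilon>>0. \<exists>u S. chaos_pair B q u S \<and>
      (\<integral>x. (f x - u x)\<^sup>2 \<partial>lebesgue_power q) < \<epsilon> \<and> (\<integral>\<omega>. (X \<omega> - S \<omega>)\<^sup>2 \<partial>M) < \<epsilon>)"
proof -
  have "(\<exists>u S. chaos_pair B q u S \<and> P u S) \<longleftrightarrow> (\<exists>(n::nat) c g.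
     (\<forall>i<n. g i \<in> L2 lborel \<and> (\<integral>x. (g i x)\<^sup>2 \<partial>lborel) = 1) \<and>
     P (\<lambda>x. \<Sum>i<n. c i * (\<Prod>j<q. g i (x j))) (\<lambda>\<omega>. \<Sum>i<n. c i * hermite q (B (g i) \<omega>)))" for P
    unfolding chaos_pair_def by blast
  from this[of "\<lambda>u S. (\<integral>x. (f x - u x)\<^sup>2 \<partial>lebesgue_power q) < \<epsilon> \<and> (\<integral>\<omega>. (X \<omega> - S \<omega>)\<^sup>2 \<partial>M) < \<epsilon>" for \<epsilon>]
  show ?thesis
    unfolding wiener_integral_def by simp
qed

lemma wiener_integral_approx:
  assumes "wiener_integral M B q f X" "\<epsilon> > 0"
  obtains u S where "chaos_pair B q u S" "(\<integral>x. (f x - u x)\<^sup>2 \<partial>lebesgue_power q) < \<epsilon>"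
    "(\<integral>\<omega>. (X \<omega> - S \<omega>)\<^sup>2 \<partial>M) < \<epsilon>"
  using assms unfolding wiener_integral_iff by blast

lemma wiener_integral_L2:
  assumes "wiener_integral M B q f X"
  shows "f \<in> L2_sym q" "f \<in> L2 (lebesgue_power q)" "X \<in> L2 M"
  using assms by (auto simp: wiener_integral_def L2_sym_def)

lemma L2_sym_add:
  assumes "f \<in> L2_sym q" "f' \<in> L2_sym q"
  shows "(\<lambda>x. f x + f' x) \<in> L2_sym q"
proof -
  have "AE x in lebesgue_power q. f (x \<circ> p) + f' (x \<circ> p) = f x + f' x" if "p permutes {..<q}" for p
  proof -
    have "AE x in lebesgue_power q. f (x \<circ> p) = f x" "AE x in lebesgue_power q. f' (x \<circ> p) = f' x"
      using assms that by (auto simp: L2_sym_def)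
    then show ?thesis by eventually_elim simp
  qed
  with assms show ?thesis
    by (auto simp: L2_sym_def intro: L2_add)
qed

lemma L2_sym_cmult:
  assumes "f \<in> L2_sym q"
  shows "(\<lambda>x. a * f x) \<in> L2_sym q"
proof -
  have "AE x in lebesgue_power q. a * f (x \<circ> p) = a * f x" if "p permutes {..<q}" for p
  proof -
    have "AE x in lebesgue_power q. f (x \<circ> p) = f x"
      using assms that by (auto simp: L2_sym_def)
    then show ?thesis by eventually_elim simp
  qed
  with assms show ?thesis
    by (auto simp: L2_sym_def intro: L2_cmult)
qed

lemma wiener_integral_zero: "wiener_integral M B q (\<lambda>x. 0) (\<lambda>\<omega>. 0)"
  unfolding wiener_integral_iff
proof (intro conjI allI impI)
  fix \<epsilon> :: real assume "\<epsilon> > 0"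
  moreover have "chaos_pair B q (\<lambda>x. 0) (\<lambda>\<omega>. 0)"
    using chaos_pair_sum[of "{}" _ B q] by simp
  ultimately show "\<exists>u S. chaos_pair B q u S \<and> (\<integral>x. (0 - u x)\<^sup>2 \<partial>lebesgue_power q) < \<epsilon> \<and> (\<integral>\<omega>. (0 - S \<omega>)\<^sup>2 \<partial>M) < \<epsilon>"
    by (intro exI[of _ "\<lambda>x. 0"] conjI) auto
qed (auto simp: L2_sym_def L2_zero)

lemma wiener_integral_add:
  assumes iso: "isonormal M B" and "wiener_integral M B q f X" "wiener_integral M B q f' X'"
  shows "wiener_integral M B q (\<lambda>x. f x + f' x) (\<lambda>\<omega>. X \<omega> + X' \<omega>)"
  unfolding wiener_integral_iff
proof (intro conjI allI impI)
  note L = wiener_integral_L2[OF assms(2)] wiener_integral_L2[OF assms(3)]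
  show "(\<lambda>x. f x + f' x) \<in> L2_sym q" "(\<lambda>\<omega>. X \<omega> + X' \<omega>) \<in> L2 M"
    using L by (auto intro: L2_sym_add L2_add)
  fix \<epsilon> :: real assume "\<epsilon> > 0"
  then have e: "\<epsilon> / 4 > 0" by simp
  obtain u S where 1: "chaos_pair B q u S" "(\<integral>x. (f x - u x)\<^sup>2 \<partial>lebesgue_power q) < \<epsilon> / 4"
    "(\<integral>\<omega>. (X \<omega> - S \<omega>)\<^sup>2 \<partial>M) < \<epsilon> / 4"
    using wiener_integral_approx[OF assms(2) e] by blast
  obtain u' S' where 2: "chaos_pair B q u' S'" "(\<integral>x. (f' x - u' x)\<^sup>2 \<partial>lebesgue_power q) < \<epsilon> / 4"
    "(\<integral>\<omega>. (X' \<omega> - S' \<omega>)\<^sup>2 \<partial>M) < \<epsilon> / 4"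
    using wiener_integral_approx[OF assms(3) e] by blast
  note C = chaos_pair_L2[OF iso 1(1)] chaos_pair_L2[OF iso 2(1)]
  have "(\<integral>x. (f x + f' x - (u x + u' x))\<^sup>2 \<partial>lebesgue_power q) < \<epsilon>"
    using L2_dist_add[OF L(2) C(1) L(5) C(3)] 1 2 by simp
  moreover have "(\<integral>\<omega>. (X \<omega> + X' \<omega> - (S \<omega> + S' \<omega>))\<^sup>2 \<partial>M) < \<epsilon>"
    using L2_dist_add[OF L(3) C(2) L(6) C(4)] 1 2 by simp
  ultimately show "\<exists>u S. chaos_pair B q u S \<and> (\<integral>x. (f x + f' x - u x)\<^sup>2 \<partial>lebesgue_power q) < \<epsilon> \<and>
      (\<integral>\<omega>. (X \<omega> + X' \<omega> - S \<omega>)\<^sup>2 \<partial>M) < \<epsilon>"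
    using chaos_pair_add[OF 1(1) 2(1)] by blast
qed

lemma wiener_integral_cmult:
  assumes "wiener_integral M B q f X"
  shows "wiener_integral M B q (\<lambda>x. a * f x) (\<lambda>\<omega>. a * X \<omega>)"
  unfolding wiener_integral_iff
proof (intro conjI allI impI)
  show "(\<lambda>x. a * f x) \<in> L2_sym q" "(\<lambda>\<omega>. a * X \<omega>) \<in> L2 M"
    using wiener_integral_L2[OF assms] by (auto intro: L2_sym_cmult L2_cmult)
  fix \<epsilon> :: real assume "\<epsilon> > 0"
  have pos: "a\<^sup>2 + 1 > 0" by (simp add: add_nonneg_pos)
  have scale: "a\<^sup>2 * t < \<epsilon>" if "t < \<epsilon> / (a\<^sup>2 + 1)" "t \<ge> 0" for t
  proof -
    have "a\<^sup>2 * t \<le> (a\<^sup>2 + 1) * t" using that by (simp add: mult_right_mono)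
    also have "\<dots> < \<epsilon>" using that(1) pos by (simp add: pos_less_divide_eq mult.commute)
    finally show ?thesis .
  qed
  obtain u S where 1: "chaos_pair B q u S" "(\<integral>x. (f x - u x)\<^sup>2 \<partial>lebesgue_power q) < \<epsilon> / (a\<^sup>2 + 1)"
    "(\<integral>\<omega>. (X \<omega> - S \<omega>)\<^sup>2 \<partial>M) < \<epsilon> / (a\<^sup>2 + 1)"
    using wiener_integral_approx[OF assms, of "\<epsilon> / (a\<^sup>2 + 1)"] pos \<open>\<epsilon> > 0\<close> by auto
  have "(\<integral>x. (a * f x - a * u x)\<^sup>2 \<partial>lebesgue_power q) < \<epsilon>" "(\<integral>\<omega>. (a * X \<omega> - a * S \<omega>)\<^sup>2 \<partial>M) < \<epsilon>"
    unfolding L2_cmult_dist using 1 by (auto intro!: scale)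
  then show "\<exists>u S. chaos_pair B q u S \<and> (\<integral>x. (a * f x - u x)\<^sup>2 \<partial>lebesgue_power q) < \<epsilon> \<and>
      (\<integral>\<omega>. (a * X \<omega> - S \<omega>)\<^sup>2 \<partial>M) < \<epsilon>"
    using chaos_pair_cmult[OF 1(1)] by blast
qed

text \<open>The graph of \<open>I\<^sub>q\<close> is defined as a closure, so that limits of elements of the graph stay in it;
  this is how all new integrals below are obtained.\<close>

lemma wiener_integral_closed:
  assumes iso: "isonormal M B" and f: "f \<in> L2_sym q" and X: "X \<in> L2 M"
    and approx: "\<And>\<epsilon>. \<epsilon> > 0 \<Longrightarrow> \<exists>f' X'. wiener_integral M B q f' X' \<and>
      (\<integral>x. (f x - f' x)\<^sup>2 \<partial>lebesgue_power q) < \<epsilon> \<and> (\<integral>\<omega>. (X \<omega> - X' \<omega>)\<^sup>2 \<partial>M) < \<epsilon>"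
  shows "wiener_integral M B q f X"
  unfolding wiener_integral_iff
proof (intro conjI allI impI f X)
  fix \<epsilon> :: real assume "\<epsilon> > 0"
  then have e: "\<epsilon> / 4 > 0" by simp
  obtain f' X' where 1: "wiener_integral M B q f' X'" "(\<integral>x. (f x - f' x)\<^sup>2 \<partial>lebesgue_power q) < \<epsilon> / 4"
    "(\<integral>\<omega>. (X \<omega> - X' \<omega>)\<^sup>2 \<partial>M) < \<epsilon> / 4"
    using approx[OF e] by blast
  obtain u S where 2: "chaos_pair B q u S" "(\<integral>x. (f' x - u x)\<^sup>2 \<partial>lebesgue_power q) < \<epsilon> / 4"
    "(\<integral>\<omega>. (X' \<omega> - S \<omega>)\<^sup>2 \<partial>M) < \<epsilon> / 4"
    using wiener_integral_approx[OF 1(1) e] by blast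
  have fL: "f \<in> L2 (lebesgue_power q)" using f by (simp add: L2_sym_def)
  note L = wiener_integral_L2[OF 1(1)] and C = chaos_pair_L2[OF iso 2(1)]
  have "(\<integral>x. (f x - u x)\<^sup>2 \<partial>lebesgue_power q) < \<epsilon>" "(\<integral>\<omega>. (X \<omega> - S \<omega>)\<^sup>2 \<partial>M) < \<epsilon>"
    using L2_dist_triangle[OF fL L(2) C(1)] L2_dist_triangle[OF X L(3) C(2)] 1 2 by simp_all
  then show "\<exists>u S. chaos_pair B q u S \<and> (\<integral>x. (f x - u x)\<^sup>2 \<partial>lebesgue_power q) < \<epsilon> \<and>
      (\<integral>\<omega>. (X \<omega> - S \<omega>)\<^sup>2 \<partial>M) < \<epsilon>"
    using 2(1) by blast
qed

lemma wiener_integral_cong_AE: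
  assumes "isonormal M B" "wiener_integral M B q f X"
    and "f' \<in> L2_sym q" "AE x in lebesgue_power q. f' x = f x"
    and "X' \<in> borel_measurable M" "AE \<omega> in M. X' \<omega> = X \<omega>"
  shows "wiener_integral M B q f' X'"
proof (rule wiener_integral_closed[OF assms(1,3)])
  show "X' \<in> L2 M"
    by (rule L2_cong_AE[OF wiener_integral_L2(3)[OF assms(2)] assms(5)]) (use assms(6) in auto)
  have "(\<integral>x. (f' x - f x)\<^sup>2 \<partial>lebesgue_power q) = 0" "(\<integral>\<omega>. (X' \<omega> - X \<omega>)\<^sup>2 \<partial>M) = 0"
    using assms(4,6) by (auto intro!: integral_eq_zero_AE)
  then show "\<exists>f'' X''. wiener_integral M B q f'' X'' \<and>
      (\<integral>x. (f' x - f'' x)\<^sup>2 \<partial>lebesgue_power q) < \<epsilon> \<and> (\<integral>\<omega>. (X' \<omega> - X'' \<omega>)\<^sup>2 \<partial>M) < \<epsilon>"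
    if "\<epsilon> > 0" for \<epsilon>
    by (intro exI[of _ f] exI[of _ X]) (use assms(2) that in simp)
qed


section \<open>The isometry of the second chaos\<close>

text \<open>Polarising the fourth moment \<open>E Z\<^sup>4 = 3 (E Z\<^sup>2)\<^sup>2\<close> of the Gaussian variables
  \<open>Z = B(g) \<plusminus> B(g')\<close> gives \<open>E (B(g) B(g'))\<^sup>2 = 1 + 2\<langle>g, g'\<rangle>\<^sup>2\<close>.\<close>

lemma hermite2_inner:
  assumes iso: "isonormal M B"
    and g: "g \<in> L2 lborel" "(\<integral>x. (g x)\<^sup>2 \<partial>lborel) = 1"
    and g': "g' \<in> L2 lborel" "(\<integral>x. (g' x)\<^sup>2 \<partial>lborel) = 1"
  shows "(\<integral>\<omega>. hermite 2 (B g \<omega>) * hermite 2 (B g' \<omega>) \<partial>M) = 2 * (\<integral>x. g x * g' x \<partial>lborel)\<^sup>2"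
proof -
  have prob: "prob_space M" and cov: "\<And>g g'. g \<in> L2 lborel \<Longrightarrow> g' \<in> L2 lborel \<Longrightarrow>
      (\<integral>\<omega>. B g \<omega> * B g' \<omega> \<partial>M) = (\<integral>x. g x * g' x \<partial>lborel)"
    using iso by (auto simp: isonormal_def)
  interpret prob_space M by (rule prob)
  define X Y where "X = B g" and "Y = B g'"
  define \<rho> where "\<rho> = (\<integral>x. g x * g' x \<partial>lborel)"
  have XX: "(\<integral>\<omega>. (X \<omega>)\<^sup>2 \<partial>M) = 1" and YY: "(\<integral>\<omega>. (Y \<omega>)\<^sup>2 \<partial>M) = 1" and XY: "(\<integral>\<omega>. X \<omega> * Y \<omega> \<partial>M) = \<rho>"
    using cov[OF g(1) g(1)] cov[OF g'(1) g'(1)] cov[OF g(1) g'(1)] g(2) g'(2)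
    by (simp_all add: X_def Y_def \<rho>_def power2_eq_square)
  have GX: "centered_gaussian M X" and GY: "centered_gaussian M Y"
    using isonormal_gaussian1[OF iso] g g' by (simp_all add: X_def Y_def)
  have Gp: "centered_gaussian M (\<lambda>\<omega>. X \<omega> + 1 * Y \<omega>)" and Gm: "centered_gaussian M (\<lambda>\<omega>. X \<omega> + (-1) * Y \<omega>)"
    using isonormal_gaussian2[OF iso g(1) g'(1)] unfolding X_def Y_def by blast+
  have [measurable]: "X \<in> borel_measurable M" "Y \<in> borel_measurable M"
    using GX GY by (simp_all add: centered_gaussian_def)
  note int = centered_gaussian_integrable[OF _ prob]
  have X2: "X \<in> L2 M" and Y2: "Y \<in> L2 M" and X4: "(\<lambda>\<omega>. (X \<omega>)\<^sup>2) \<in> L2 M" and Y4: "(\<lambda>\<omega>. (Y \<omega>)\<^sup>2) \<in> L2 M"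
    using int[OF GX, of 2] int[OF GY, of 2] int[OF GX, of 4] int[OF GY, of 4]
    by (auto intro!: L2_I)
  note i2 = L2_mult_integrable[OF X2 Y2] L2_integrable[OF X2] L2_integrable[OF Y2]
  note i4 = L2_mult_integrable[OF X4 Y4] int[OF GX, of 4] int[OF GY, of 4] int[OF Gp, of 4] int[OF Gm, of 4]
  have second: "(\<integral>\<omega>. (X \<omega> + a * Y \<omega>)\<^sup>2 \<partial>M) = 1 + a\<^sup>2 + 2 * a * \<rho>" for a
  proof -
    have "(\<integral>\<omega>. (X \<omega> + a * Y \<omega>)\<^sup>2 \<partial>M) = (\<integral>\<omega>. (X \<omega>)\<^sup>2 + a\<^sup>2 * (Y \<omega>)\<^sup>2 + (2 * a) * (X \<omega> * Y \<omega>) \<partial>M)"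
      by (intro Bochner_Integration.integral_cong) (auto simp: power2_eq_square algebra_simps)
    also have "\<dots> = 1 + a\<^sup>2 + 2 * a * \<rho>"
      using i2 by (simp add: XX YY XY)
    finally show ?thesis .
  qed
  have "(\<integral>\<omega>. (X \<omega> + 1 * Y \<omega>) ^ 4 + (X \<omega> + (-1) * Y \<omega>) ^ 4 \<partial>M)
      = (\<integral>\<omega>. 2 * X \<omega> ^ 4 + 2 * Y \<omega> ^ 4 + 12 * ((X \<omega>)\<^sup>2 * (Y \<omega>)\<^sup>2) \<partial>M)"
    by (intro Bochner_Integration.integral_cong) (auto simp: power2_eq_square power4_eq_xxxx algebra_simps)
  moreover have "(\<integral>\<omega>. (X \<omega> + 1 * Y \<omega>) ^ 4 + (X \<omega> + (-1) * Y \<omega>) ^ 4 \<partial>M)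
      = (\<integral>\<omega>. (X \<omega> + 1 * Y \<omega>) ^ 4 \<partial>M) + (\<integral>\<omega>. (X \<omega> + (-1) * Y \<omega>) ^ 4 \<partial>M)"
    by (rule Bochner_Integration.integral_add) (rule i4)+
  moreover have "(\<integral>\<omega>. 2 * X \<omega> ^ 4 + 2 * Y \<omega> ^ 4 + 12 * ((X \<omega>)\<^sup>2 * (Y \<omega>)\<^sup>2) \<partial>M)
      = 2 * 3 + 2 * 3 + 12 * (\<integral>\<omega>. (X \<omega>)\<^sup>2 * (Y \<omega>)\<^sup>2 \<partial>M)"
    using i4 centered_gaussian_fourth[OF GX] centered_gaussian_fourth[OF GY] by (simp add: XX YY)
  ultimately have fourth: "(\<integral>\<omega>. (X \<omega>)\<^sup>2 * (Y \<omega>)\<^sup>2 \<partial>M) = 1 + 2 * \<rho>\<^sup>2"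
    unfolding centered_gaussian_fourth[OF Gp] centered_gaussian_fourth[OF Gm] second
    by (simp add: power2_eq_square algebra_simps)
  have h2: "hermite 2 x = x\<^sup>2 - 1" for x
    by (simp add: numeral_2_eq_2 power2_eq_square)
  have "(\<integral>\<omega>. hermite 2 (X \<omega>) * hermite 2 (Y \<omega>) \<partial>M)
      = (\<integral>\<omega>. (X \<omega>)\<^sup>2 * (Y \<omega>)\<^sup>2 - (X \<omega>)\<^sup>2 - (Y \<omega>)\<^sup>2 + 1 \<partial>M)"
    by (intro Bochner_Integration.integral_cong) (auto simp: h2 algebra_simps)
  also have "\<dots> = 2 * \<rho>\<^sup>2"
    using i2 i4 by (simp add: fourth XX YY prob_space)
  finally show ?thesis by (simp add: X_def Y_def \<rho>_def)
qed

lemma L2_sum_norm_sq: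
  fixes n :: nat
  assumes "\<And>i. i < n \<Longrightarrow> a i \<in> L2 N"
  shows "(\<integral>x. (\<Sum>i<n. c i * a i x)\<^sup>2 \<partial>N) = (\<Sum>i<n. \<Sum>j<n. c i * c j * (\<integral>x. a i x * a j x \<partial>N))"
proof -
  have int: "integrable N (\<lambda>x. c i * c j * (a i x * a j x))" if "i < n" "j < n" for i j
    using that by (intro integrable_mult_right L2_mult_integrable assms)
  have "(\<integral>x. (\<Sum>i<n. c i * a i x)\<^sup>2 \<partial>N) = (\<integral>x. (\<Sum>i<n. \<Sum>j<n. c i * c j * (a i x * a j x)) \<partial>N)"
    by (simp add: power2_eq_square sum_product mult_ac)
  also have "\<dots> = (\<Sum>i<n. \<integral>x. (\<Sum>j<n. c i * c j * (a i x * a j x)) \<partial>N)"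
    by (intro Bochner_Integration.integral_sum Bochner_Integration.integrable_sum int) auto
  also have "\<dots> = (\<Sum>i<n. \<Sum>j<n. \<integral>x. c i * c j * (a i x * a j x) \<partial>N)"
    by (intro sum.cong refl Bochner_Integration.integral_sum int) auto
  finally show ?thesis by simp
qed

lemma chaos2_isometry:
  assumes iso: "isonormal M B" and "chaos_pair B 2 u S"
  shows "(\<integral>\<omega>. (S \<omega>)\<^sup>2 \<partial>M) = 2 * (\<integral>x. (u x)\<^sup>2 \<partial>lebesgue_power 2)"
proof -
  obtain n :: nat and c g where g: "\<And>i. i < n \<Longrightarrow> g i \<in> L2 lborel" "\<And>i. i < n \<Longrightarrow> (\<integral>x. (g i x)\<^sup>2 \<partial>lborel) = 1"
    and u: "u = (\<lambda>x. \<Sum>i<n. c i * (\<Prod>j<2. g i (x j)))" and S: "S = (\<lambda>\<omega>. \<Sum>i<n. c i * hermite 2 (B (g i) \<omega>))"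
    using assms(2) unfolding chaos_pair_def by blast
  have "(\<integral>\<omega>. (S \<omega>)\<^sup>2 \<partial>M) = (\<Sum>i<n. \<Sum>j<n. c i * c j * (\<integral>\<omega>. hermite 2 (B (g i) \<omega>) * hermite 2 (B (g j) \<omega>) \<partial>M))"
    unfolding S by (rule L2_sum_norm_sq) (rule hermite_L2[OF iso g(1)])
  also have "\<dots> = 2 * (\<Sum>i<n. \<Sum>j<n. c i * c j * (\<integral>x. (\<Prod>l<2. g i (x l)) * (\<Prod>l<2. g j (x l)) \<partial>lebesgue_power 2))"
    unfolding sum_distrib_left using g
    by (intro sum.cong refl) (simp add: hermite2_inner[OF iso] tensor_power_inner)
  also have "(\<Sum>i<n. \<Sum>j<n. c i * c j * (\<integral>x. (\<Prod>l<2. g i (x l)) * (\<Prod>l<2. g j (x l)) \<partial>lebesgue_power 2))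
      = (\<integral>x. (u x)\<^sup>2 \<partial>lebesgue_power 2)"
    unfolding u by (rule L2_sum_norm_sq[symmetric]) (rule tensor_power_L2[OF g(1)])
  finally show ?thesis .
qed

text \<open>The isometry survives the passage to the closure, so that a random variable determines
  its kernel.\<close>

lemma second_chaos_kernel_unique:
  assumes iso: "isonormal M B" and f: "wiener_integral M B 2 f X" and f': "wiener_integral M B 2 f' X"
  shows "AE x in lebesgue_power 2. f x = f' x"
proof -
  note L = wiener_integral_L2[OF f] wiener_integral_L2[OF f']
  define d where "d = (\<integral>x. (f x - f' x)\<^sup>2 \<partial>lebesgue_power 2)"
  have "\<And>\<epsilon>. 0 < \<epsilon> \<Longrightarrow> d \<le> \<epsilon>"
  proof -
    fix \<epsilon> :: real assume that: "0 < \<epsilon>"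
    then have e: "\<epsilon> / 16 > 0" by simp
    obtain u S where 1: "chaos_pair B 2 u S" "(\<integral>x. (f x - u x)\<^sup>2 \<partial>lebesgue_power 2) < \<epsilon> / 16"
      "(\<integral>\<omega>. (X \<omega> - S \<omega>)\<^sup>2 \<partial>M) < \<epsilon> / 16"
      using wiener_integral_approx[OF f e] by blast
    obtain u' S' where 2: "chaos_pair B 2 u' S'" "(\<integral>x. (f' x - u' x)\<^sup>2 \<partial>lebesgue_power 2) < \<epsilon> / 16"
      "(\<integral>\<omega>. (X \<omega> - S' \<omega>)\<^sup>2 \<partial>M) < \<epsilon> / 16"
      using wiener_integral_approx[OF f' e] by blast
    note C = chaos_pair_L2[OF iso 1(1)] chaos_pair_L2[OF iso 2(1)]
    have "(\<integral>\<omega>. (S \<omega> - X \<omega>)\<^sup>2 \<partial>M) < \<epsilon> / 16"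
      using 1(3) by (simp add: power2_commute)
    then have "(\<integral>\<omega>. (S \<omega> - S' \<omega>)\<^sup>2 \<partial>M) \<le> \<epsilon> / 4"
      using L2_dist_triangle[OF C(2) L(3) C(4)] 2(3) by linarith
    moreover
    have "chaos_pair B 2 (\<lambda>x. u x - u' x) (\<lambda>\<omega>. S \<omega> - S' \<omega>)"
      using chaos_pair_add[OF 1(1) chaos_pair_cmult[OF 2(1), of "-1"]] by simp
    note chaos2_isometry[OF iso this]
    ultimately have "(\<integral>x. (u x - u' x)\<^sup>2 \<partial>lebesgue_power 2) \<le> \<epsilon> / 8" by linarith
    moreover have "(\<integral>x. (u x - f' x)\<^sup>2 \<partial>lebesgue_power 2)
        \<le> 2 * (\<integral>x. (u x - u' x)\<^sup>2 \<partial>lebesgue_power 2) + 2 * (\<integral>x. (u' x - f' x)\<^sup>2 \<partial>lebesgue_power 2)"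
      by (rule L2_dist_triangle[OF C(1) C(3) L(5)])
    moreover have "d \<le> 2 * (\<integral>x. (f x - u x)\<^sup>2 \<partial>lebesgue_power 2) + 2 * (\<integral>x. (u x - f' x)\<^sup>2 \<partial>lebesgue_power 2)"
      unfolding d_def by (rule L2_dist_triangle[OF L(2) C(1) L(5)])
    moreover have "(\<integral>x. (u' x - f' x)\<^sup>2 \<partial>lebesgue_power 2) < \<epsilon> / 16"
      using 2(2) by (simp add: power2_commute)
    ultimately show "d \<le> \<epsilon>" using 1(2) that by linarith
  qed
  then have "d \<le> 0" by (rule dense_ge)
  moreover have "d \<ge> 0" unfolding d_def by simp
  ultimately have "d = 0" by simp
  then have "AE x in lebesgue_power 2. (f x - f' x)\<^sup>2 = 0"
    unfolding d_def using L2_integrable[OF L2_diff[OF L(2) L(5)]]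
    by (subst (asm) integral_nonneg_eq_0_iff_AE) auto
  then show ?thesis by simp
qed


section \<open>Averages of Wiener--Ito integrals\<close>

lemma (in prob_space) L2_const: "(\<lambda>_. d) \<in> L2 M"
  by (rule L2_I) auto

lemma (in prob_space) L2_imp_integrable: "\<phi> \<in> L2 M \<Longrightarrow> integrable M \<phi>"
  using L2_mult_integrable[OF _ L2_const[of 1], of \<phi>] by simp

lemma (in prob_space) shifted_variance:
  fixes d :: real
  assumes "\<phi> \<in> L2 M"
  defines "m \<equiv> (\<integral>r. \<phi> r \<partial>M)"
  shows "(\<integral>r. (d + (\<phi> r - m))\<^sup>2 \<partial>M) = d\<^sup>2 + (\<integral>r. (\<phi> r)\<^sup>2 \<partial>M) - m\<^sup>2"
proof -
  have "(\<integral>r. (d + (\<phi> r - m))\<^sup>2 \<partial>M) = (\<integral>r. (\<phi> r)\<^sup>2 + 2 * (d - m) * \<phi> r + (d - m)\<^sup>2 \<partial>M)"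
    by (intro Bochner_Integration.integral_cong) (auto simp: power2_eq_square algebra_simps)
  also have "\<dots> = (\<integral>r. (\<phi> r)\<^sup>2 \<partial>M) + 2 * (d - m) * m + (d - m)\<^sup>2"
    using L2_integrable[OF assms(1)] L2_imp_integrable[OF assms(1)] by (simp add: m_def prob_space)
  finally show ?thesis by (simp add: power2_eq_square algebra_simps)
qed

lemma (in prob_space) L2_mean_sq:
  assumes "\<phi> \<in> L2 M"
  shows "(\<integral>r. \<phi> r \<partial>M)\<^sup>2 \<le> (\<integral>r. (\<phi> r)\<^sup>2 \<partial>M)"
proof -
  have "0 \<le> (\<integral>r. (0 + (\<phi> r - (\<integral>r. \<phi> r \<partial>M)))\<^sup>2 \<partial>M)" by simp
  then show ?thesis unfolding shifted_variance[OF assms] by simp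
qed

lemma (in prob_space) nn_shifted_variance_le:
  fixes d :: real
  assumes "\<phi> \<in> L2 M"
  shows "(\<integral>\<^sup>+r. ennreal ((d + (\<phi> r - (\<integral>r. \<phi> r \<partial>M)))\<^sup>2) \<partial>M) \<le> ennreal (d\<^sup>2) + (\<integral>\<^sup>+r. ennreal ((\<phi> r)\<^sup>2) \<partial>M)"
proof -
  have "(\<integral>\<^sup>+r. ennreal ((d + (\<phi> r - (\<integral>r. \<phi> r \<partial>M)))\<^sup>2) \<partial>M)
      = ennreal (\<integral>r. (d + (\<phi> r - (\<integral>r. \<phi> r \<partial>M)))\<^sup>2 \<partial>M)"
    by (intro nn_integral_eq_integral L2_integrable L2_add L2_diff L2_const assms) simp
  also have "\<dots> \<le> ennreal (d\<^sup>2 + (\<integral>r. (\<phi> r)\<^sup>2 \<partial>M))"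
    unfolding shifted_variance[OF assms] by (intro ennreal_leI) simp
  also have "\<dots> = ennreal (d\<^sup>2) + (\<integral>\<^sup>+r. ennreal ((\<phi> r)\<^sup>2) \<partial>M)"
    using L2_integrable[OF assms] by (simp add: nn_integral_eq_integral)
  finally show ?thesis .
qed

text \<open>One step of random sampling. If the point \<open>r\<close> is drawn at random, then adding the fluctuation of
  \<open>G r\<close> about its mean to an error \<open>D\<close> raises the expected squared norm of the error by at most the
  total second moment of \<open>G\<close>: the cross term averages to zero, and a variance is at most a second
  moment.\<close>

lemma
  assumes P: "prob_space P" and N: "sigma_finite_measure N" and G: "case_prod G \<in> L2 (P \<Otimes>\<^sub>M N)"
  shows mean_in_L2: "(\<lambda>x. \<integral>r. G r x \<partial>P) \<in> L2 N"
    and resampling_bound: "D \<in> borel_measurable N \<Longrightarrow>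
      (\<integral>\<^sup>+r. \<integral>\<^sup>+x. ennreal ((D x + (G r x - (\<integral>r. G r x \<partial>P)))\<^sup>2) \<partial>N \<partial>P)
        \<le> (\<integral>\<^sup>+x. ennreal ((D x)\<^sup>2) \<partial>N) + ennreal (\<integral>z. (case_prod G z)\<^sup>2 \<partial>(P \<Otimes>\<^sub>M N))"
proof -
  interpret P: prob_space P by fact
  interpret N: sigma_finite_measure N by fact
  interpret pair_sigma_finite P N ..
  have [measurable]: "case_prod G \<in> borel_measurable (P \<Otimes>\<^sub>M N)" using G by (rule L2_measurable)
  have Gint: "integrable (P \<Otimes>\<^sub>M N) (\<lambda>z. (case_prod G z)\<^sup>2)" by (rule L2_integrable[OF G])
  then have "integrable (P \<Otimes>\<^sub>M N) (\<lambda>(r, x). (G r x)\<^sup>2)" by (simp add: case_prod_unfold)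
  note AE_integrable_snd[OF this]
  with AE_space have sec: "AE x in N. (\<lambda>r. G r x) \<in> L2 P"
  proof eventually_elim
    case (elim x)
    then have "(\<lambda>r. G r x) \<in> borel_measurable P" by measurable
    with elim show ?case by (intro L2_I)
  qed
  have total: "(\<integral>\<^sup>+x. \<integral>\<^sup>+r. ennreal ((G r x)\<^sup>2) \<partial>P \<partial>N) = ennreal (\<integral>z. (case_prod G z)\<^sup>2 \<partial>(P \<Otimes>\<^sub>M N))"
  proof -
    have "(\<integral>\<^sup>+x. \<integral>\<^sup>+r. ennreal ((case_prod G (r, x))\<^sup>2) \<partial>P \<partial>N) = (\<integral>\<^sup>+z. ennreal ((case_prod G z)\<^sup>2) \<partial>(P \<Otimes>\<^sub>M N))"
      by (rule nn_integral_snd) measurable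
    also have "\<dots> = ennreal (\<integral>z. (case_prod G z)\<^sup>2 \<partial>(P \<Otimes>\<^sub>M N))"
      by (rule nn_integral_eq_integral[OF Gint]) simp
    finally show ?thesis by simp
  qed
  have [measurable]: "(\<lambda>x. \<integral>r. G r x \<partial>P) \<in> borel_measurable N"
    by measurable
  show "(\<lambda>x. \<integral>r. G r x \<partial>P) \<in> L2 N"
  proof (rule L2_I)
    have "(\<integral>\<^sup>+x. ennreal ((\<integral>r. G r x \<partial>P)\<^sup>2) \<partial>N) \<le> (\<integral>\<^sup>+x. \<integral>\<^sup>+r. ennreal ((G r x)\<^sup>2) \<partial>P \<partial>N)"
    proof (rule nn_integral_mono_AE)
      show "AE x in N. ennreal ((\<integral>r. G r x \<partial>P)\<^sup>2) \<le> (\<integral>\<^sup>+r. ennreal ((G r x)\<^sup>2) \<partial>P)"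
        using sec
      proof eventually_elim
        case (elim x)
        have "(\<integral>\<^sup>+r. ennreal ((G r x)\<^sup>2) \<partial>P) = ennreal (\<integral>r. (G r x)\<^sup>2 \<partial>P)"
          by (rule nn_integral_eq_integral[OF L2_integrable[OF elim]]) simp
        with P.L2_mean_sq[OF elim] show ?case by (simp add: ennreal_leI)
      qed
    qed
    also have "\<dots> < \<infinity>" unfolding total by simp
    finally show "integrable N (\<lambda>x. (\<integral>r. G r x \<partial>P)\<^sup>2)"
      by (intro integrableI_bounded) auto
  qed measurable
  assume [measurable]: "D \<in> borel_measurable N"
  have "(\<integral>\<^sup>+r. \<integral>\<^sup>+x. ennreal ((D x + (G r x - (\<integral>r. G r x \<partial>P)))\<^sup>2) \<partial>N \<partial>P)
      = (\<integral>\<^sup>+x. \<integral>\<^sup>+r. ennreal ((D x + (G r x - (\<integral>r. G r x \<partial>P)))\<^sup>2) \<partial>P \<partial>N)"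
    by (rule Fubini'[symmetric]) measurable
  also have "\<dots> \<le> (\<integral>\<^sup>+x. ennreal ((D x)\<^sup>2) + (\<integral>\<^sup>+r. ennreal ((G r x)\<^sup>2) \<partial>P) \<partial>N)"
    using sec by (intro nn_integral_mono_AE) (auto elim!: eventually_mono intro: P.nn_shifted_variance_le)
  also have "\<dots> = (\<integral>\<^sup>+x. ennreal ((D x)\<^sup>2) \<partial>N) + (\<integral>\<^sup>+x. \<integral>\<^sup>+r. ennreal ((G r x)\<^sup>2) \<partial>P \<partial>N)"
    by (rule nn_integral_add) measurable
  finally show "(\<integral>\<^sup>+r. \<integral>\<^sup>+x. ennreal ((D x + (G r x - (\<integral>r. G r x \<partial>P)))\<^sup>2) \<partial>N \<partial>P)
        \<le> (\<integral>\<^sup>+x. ennreal ((D x)\<^sup>2) \<partial>N) + ennreal (\<integral>z. (case_prod G z)\<^sup>2 \<partial>(P \<Otimes>\<^sub>M N))"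
    unfolding total .
qed

text \<open>The graph of \<open>I\<^sub>q\<close> is closed under averages over a parameter \<open>r\<close>. The average is reached by finite
  sums, as in the law of large numbers: the points \<open>r\<close> are selected one after the other, each so that
  the joint squared error of the sum of the first \<open>n\<close> kernels and of the first \<open>n\<close> variables, taken
  around \<open>n\<close> times the respective average, is at most \<open>n (v + 1)\<close>. Such a point exists because a random
  point adds no more than \<open>v\<close> in expectation. After division by \<open>n\<close> the squared error is at most
  \<open>(v + 1) / n\<close>.\<close>

lemma wiener_integral_mean:
  assumes iso: "isonormal M B" and P: "prob_space P"
    and g: "case_prod g \<in> L2 (P \<Otimes>\<^sub>M lebesgue_power q)"
    and Z: "case_prod Z \<in> L2 (P \<Otimes>\<^sub>M M)"
    and wi: "AE r in P. wiener_integral M B q (g r) (Z r)"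
    and f: "f \<in> L2_sym q" "AE x in lebesgue_power q. f x = (\<integral>r. g r x \<partial>P)"
  shows "wiener_integral M B q f (\<lambda>\<omega>. \<integral>r. Z r \<omega> \<partial>P)"
proof -
  interpret P: prob_space P by fact
  interpret M: prob_space M using iso by (simp add: isonormal_def)
  interpret Q: finite_product_sigma_finite "\<lambda>_::nat. lborel :: real measure" "{..<q}" by standard simp
  note sM = M.sigma_finite_measure_axioms and sQ = Q.sigma_finite_measure_axioms
  define m where "m x = (\<integral>r. g r x \<partial>P)" for x
  define Y where "Y \<omega> = (\<integral>r. Z r \<omega> \<partial>P)" for \<omega>
  have mL: "m \<in> L2 (lebesgue_power q)" and YL: "Y \<in> L2 M"
    using mean_in_L2[OF P sQ g] mean_in_L2[OF P sM Z] by (simp_all add: m_def[abs_def] Y_def[abs_def])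
  have [measurable]: "m \<in> borel_measurable (lebesgue_power q)" "Y \<in> borel_measurable M"
    "case_prod g \<in> borel_measurable (P \<Otimes>\<^sub>M lebesgue_power q)" "case_prod Z \<in> borel_measurable (P \<Otimes>\<^sub>M M)"
    using mL YL g Z by (auto dest: L2_measurable)
  define v where "v = (\<integral>z. (case_prod g z)\<^sup>2 \<partial>(P \<Otimes>\<^sub>M lebesgue_power q)) + (\<integral>z. (case_prod Z z)\<^sup>2 \<partial>(P \<Otimes>\<^sub>M M))"
  have v0: "v \<ge> 0" by (simp add: v_def)
  have sample: "\<exists>u S. wiener_integral M B q u S \<and>
      (\<integral>\<^sup>+x. ennreal ((u x - real n * m x)\<^sup>2) \<partial>lebesgue_power q) + (\<integral>\<^sup>+\<omega>. ennreal ((S \<omega> - real n * Y \<omega>)\<^sup>2) \<partial>M)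
        \<le> ennreal (real n * (v + 1))" for n :: nat
  proof (induction n)
    case 0
    show ?case
      by (rule exI[of _ "\<lambda>x. 0"], rule exI[of _ "\<lambda>\<omega>. 0"]) (simp add: wiener_integral_zero)
  next
    case (Suc n)
    then obtain u S where uS: "wiener_integral M B q u S"
      "(\<integral>\<^sup>+x. ennreal ((u x - real n * m x)\<^sup>2) \<partial>lebesgue_power q) + (\<integral>\<^sup>+\<omega>. ennreal ((S \<omega> - real n * Y \<omega>)\<^sup>2) \<partial>M)
        \<le> ennreal (real n * (v + 1))" by blast
    have [measurable]: "u \<in> borel_measurable (lebesgue_power q)" "S \<in> borel_measurable M"
      using wiener_integral_L2[OF uS(1)] by (auto dest: L2_measurable)
    define E1 where "E1 r = (\<integral>\<^sup>+x. ennreal ((u x - real n * m x + (g r x - m x))\<^sup>2) \<partial>lebesgue_power q)" for r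
    define E2 where "E2 r = (\<integral>\<^sup>+\<omega>. ennreal ((S \<omega> - real n * Y \<omega> + (Z r \<omega> - Y \<omega>))\<^sup>2) \<partial>M)" for r
    have [measurable]: "E1 \<in> borel_measurable P" "E2 \<in> borel_measurable P"
      unfolding E1_def[abs_def] E2_def[abs_def] by measurable
    have "(\<integral>\<^sup>+r. E1 r + E2 r \<partial>P) = (\<integral>\<^sup>+r. E1 r \<partial>P) + (\<integral>\<^sup>+r. E2 r \<partial>P)"
      by (rule nn_integral_add) measurable
    also have "\<dots> \<le> ((\<integral>\<^sup>+x. ennreal ((u x - real n * m x)\<^sup>2) \<partial>lebesgue_power q)
          + ennreal (\<integral>z. (case_prod g z)\<^sup>2 \<partial>(P \<Otimes>\<^sub>M lebesgue_power q)))
        + ((\<integral>\<^sup>+\<omega>. ennreal ((S \<omega> - real n * Y \<omega>)\<^sup>2) \<partial>M) + ennreal (\<integral>z. (case_prod Z z)\<^sup>2 \<partial>(P \<Otimes>\<^sub>M M)))"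
      unfolding E1_def E2_def m_def Y_def
      by (intro add_mono resampling_bound[OF P sQ g] resampling_bound[OF P sM Z]) (fold m_def Y_def, measurable)
    also have "\<dots> = ((\<integral>\<^sup>+x. ennreal ((u x - real n * m x)\<^sup>2) \<partial>lebesgue_power q)
        + (\<integral>\<^sup>+\<omega>. ennreal ((S \<omega> - real n * Y \<omega>)\<^sup>2) \<partial>M)) + ennreal v"
      unfolding v_def by (subst ennreal_plus) (auto simp: add_ac)
    also have "\<dots> \<le> ennreal (real n * (v + 1)) + ennreal v"
      using uS(2) by (intro add_mono) auto
    also have "\<dots> = ennreal (real n * (v + 1) + v)"
      using v0 by (subst ennreal_plus) auto
    also have "\<dots> < ennreal (real (Suc n) * (v + 1))"
    proof (rule ennreal_lessI)
      show "0 < real (Suc n) * (v + 1)" using v0 by (intro mult_pos_pos) auto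
    qed (simp add: algebra_simps)
    finally have less: "(\<integral>\<^sup>+r. E1 r + E2 r \<partial>P) < ennreal (real (Suc n) * (v + 1))" .
    \<comment> \<open>The inequality is strict because of the summand 1 in v + 1, so that the exceptional null set
      of r cannot contain all points that satisfy the bound.\<close>
    have "\<exists>r. wiener_integral M B q (g r) (Z r) \<and> E1 r + E2 r \<le> ennreal (real (Suc n) * (v + 1))"
    proof (rule ccontr)
      assume "\<not> ?thesis"
      then have "AE r in P. ennreal (real (Suc n) * (v + 1)) \<le> E1 r + E2 r"
        using wi by (auto elim!: eventually_mono)
      then have "(\<integral>\<^sup>+r. ennreal (real (Suc n) * (v + 1)) \<partial>P) \<le> (\<integral>\<^sup>+r. E1 r + E2 r \<partial>P)"
        by (rule nn_integral_mono_AE)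
      with less show False by (simp add: P.emeasure_space_1)
    qed
    then obtain r where r: "wiener_integral M B q (g r) (Z r)" "E1 r + E2 r \<le> ennreal (real (Suc n) * (v + 1))"
      by blast
    have eq: "u x + g r x - real (Suc n) * m x = u x - real n * m x + (g r x - m x)"
      "S \<omega> + Z r \<omega> - real (Suc n) * Y \<omega> = S \<omega> - real n * Y \<omega> + (Z r \<omega> - Y \<omega>)" for x \<omega>
      by (simp_all add: algebra_simps)
    show ?case
      by (rule exI[of _ "\<lambda>x. u x + g r x"], rule exI[of _ "\<lambda>\<omega>. S \<omega> + Z r \<omega>"])
        (use wiener_integral_add[OF iso uS(1) r(1)] r(2) in \<open>simp only: eq E1_def E2_def simp_thms\<close>)
  qed
  show ?thesis
    unfolding Y_def[symmetric]
  proof (rule wiener_integral_closed[OF iso f(1) YL])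
    fix \<epsilon> :: real assume "\<epsilon> > 0"
    obtain k :: nat where k: "(v + 1) / \<epsilon> < real k" using reals_Archimedean2 by blast
    define n where "n = Suc k"
    have n: "n > 0" "v + 1 < \<epsilon> * real n"
      using k \<open>\<epsilon> > 0\<close> by (auto simp: n_def field_simps)
    obtain u S where uS: "wiener_integral M B q u S"
      "(\<integral>\<^sup>+x. ennreal ((u x - real n * m x)\<^sup>2) \<partial>lebesgue_power q) + (\<integral>\<^sup>+\<omega>. ennreal ((S \<omega> - real n * Y \<omega>)\<^sup>2) \<partial>M)
        \<le> ennreal (real n * (v + 1))" using sample by blast
    note L = wiener_integral_L2[OF uS(1)]
    have "ennreal (\<integral>x. (u x - real n * m x)\<^sup>2 \<partial>lebesgue_power q) + ennreal (\<integral>\<omega>. (S \<omega> - real n * Y \<omega>)\<^sup>2 \<partial>M)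
        \<le> ennreal (real n * (v + 1))"
      using uS(2) by (simp only: nn_integral_sq_diff[OF L(2) L2_cmult[OF mL]] nn_integral_sq_diff[OF L(3) L2_cmult[OF YL]])
    then have bound: "(\<integral>x. (u x - real n * m x)\<^sup>2 \<partial>lebesgue_power q) + (\<integral>\<omega>. (S \<omega> - real n * Y \<omega>)\<^sup>2 \<partial>M) \<le> real n * (v + 1)"
      using v0 by (subst (asm) ennreal_plus[symmetric]) (auto simp del: ennreal_plus)
    have small: "(1 / real n)\<^sup>2 * t < \<epsilon>" if "t \<le> real n * (v + 1)" for t
    proof -
      have "(1 / real n)\<^sup>2 * t \<le> (1 / real n)\<^sup>2 * (real n * (v + 1))" using that by (intro mult_left_mono) auto
      also have "\<dots> = (v + 1) / real n" using n by (simp add: power2_eq_square)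
      also have "\<dots> < \<epsilon>" using n by (simp add: divide_less_eq)
      finally show ?thesis .
    qed
    have scale: "(a - (1 / real n) * b)\<^sup>2 = (1 / real n)\<^sup>2 * (b - real n * a)\<^sup>2" for a b
    proof -
      have "a - (1 / real n) * b = - (1 / real n) * (b - real n * a)" using n by (simp add: field_simps)
      then show ?thesis by (simp only: power_mult_distrib power2_minus)
    qed
    have "(\<integral>x. (f x - (1 / real n) * u x)\<^sup>2 \<partial>lebesgue_power q) = (\<integral>x. (m x - (1 / real n) * u x)\<^sup>2 \<partial>lebesgue_power q)"
    proof (rule integral_cong_AE)
      have "f \<in> borel_measurable (lebesgue_power q)" "u \<in> borel_measurable (lebesgue_power q)"
        using f(1) L by (auto simp: L2_sym_def dest: L2_measurable)
      note [measurable] = this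
      show "(\<lambda>x. (f x - (1 / real n) * u x)\<^sup>2) \<in> borel_measurable (lebesgue_power q)"
        "(\<lambda>x. (m x - (1 / real n) * u x)\<^sup>2) \<in> borel_measurable (lebesgue_power q)"
        by measurable
      show "AE x in lebesgue_power q. (f x - (1 / real n) * u x)\<^sup>2 = (m x - (1 / real n) * u x)\<^sup>2"
        using f(2) by eventually_elim (simp add: m_def)
    qed
    also have "\<dots> = (1 / real n)\<^sup>2 * (\<integral>x. (u x - real n * m x)\<^sup>2 \<partial>lebesgue_power q)"
      unfolding scale by simp
    also have "\<dots> < \<epsilon>"
    proof (rule small)
      have "0 \<le> (\<integral>\<omega>. (S \<omega> - real n * Y \<omega>)\<^sup>2 \<partial>M)" by simp
      with bound show "(\<integral>x. (u x - real n * m x)\<^sup>2 \<partial>lebesgue_power q) \<le> real n * (v + 1)" by linarith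
    qed
    finally have 1: "(\<integral>x. (f x - (1 / real n) * u x)\<^sup>2 \<partial>lebesgue_power q) < \<epsilon>" .
    have "(\<integral>\<omega>. (Y \<omega> - (1 / real n) * S \<omega>)\<^sup>2 \<partial>M) = (1 / real n)\<^sup>2 * (\<integral>\<omega>. (S \<omega> - real n * Y \<omega>)\<^sup>2 \<partial>M)"
      unfolding scale by simp
    also have "\<dots> < \<epsilon>"
    proof (rule small)
      have "0 \<le> (\<integral>x. (u x - real n * m x)\<^sup>2 \<partial>lebesgue_power q)" by simp
      with bound show "(\<integral>\<omega>. (S \<omega> - real n * Y \<omega>)\<^sup>2 \<partial>M) \<le> real n * (v + 1)" by linarith
    qed
    finally have 2: "(\<integral>\<omega>. (Y \<omega> - (1 / real n) * S \<omega>)\<^sup>2 \<partial>M) < \<epsilon>" .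
    show "\<exists>f' X'. wiener_integral M B q f' X' \<and>
        (\<integral>x. (f x - f' x)\<^sup>2 \<partial>lebesgue_power q) < \<epsilon> \<and> (\<integral>\<omega>. (Y \<omega> - X' \<omega>)\<^sup>2 \<partial>M) < \<epsilon>"
      using wiener_integral_cmult[OF uS(1), of "1 / real n"] 1 2 by blast
  qed
qed


section \<open>The Abel kernel\<close>

lemma pos_power_measurable [measurable]: "pos_power b \<in> borel_measurable borel"
  unfolding pos_power_def[abs_def] by measurable

lemma pos_power_nonneg [simp]: "pos_power b x \<ge> 0"
  by (simp add: pos_power_def)

lemma pos_power_eq_0 [simp]: "x \<le> 0 \<Longrightarrow> pos_power b x = 0"
  by (simp add: pos_power_def)

lemma pos_power_mult: "t > 0 \<Longrightarrow> pos_power b (t * u) = t powr (- b) * pos_power b u"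
  by (auto simp: pos_power_def powr_mult zero_less_mult_iff)

lemma pos_power_nn_integral:
  assumes "b < 1"
  shows "(\<integral>\<^sup>+u. ennreal (indicator {0..1} u * pos_power b u) \<partial>lborel) = ennreal (1 / (1 - b))"
proof -
  have "(\<integral>\<^sup>+u. ennreal (indicator {0..1} u * (u powr (- b))) \<partial>lborel) = ennreal (1 powr (- b + 1) / (- b + 1))"
  proof (rule nn_integral_has_integral_lborel)
    have "(\<lambda>u::real. indicator {0..1} u * (u powr (- b))) = (\<lambda>u. if u \<in> {0..1} then u powr (- b) else 0)"
      by (auto simp: indicator_def)
    then show "((\<lambda>u::real. indicator {0..1} u * (u powr (- b))) has_integral 1 powr (- b + 1) / (- b + 1)) UNIV"
      using has_integral_powr_from_0[of "- b" 1] assms by (simp only: has_integral_restrict_UNIV)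
  qed auto
  moreover have "indicator {0..1} u * (u powr (- b)) = indicator {0..1} u * pos_power b u" for u :: real
    by (auto simp: pos_power_def indicator_def)
  ultimately show ?thesis by simp
qed

lemma pos_power_integrable:
  assumes "b < 1"
  shows "integrable lborel (\<lambda>u. indicator {0..1} u * pos_power b u)"
proof (rule integrableI_bounded)
  have "(\<integral>\<^sup>+u. ennreal (norm (indicator {0..1} u * pos_power b u)) \<partial>lborel) = ennreal (1 / (1 - b))"
    unfolding pos_power_nn_integral[OF assms, symmetric] by (intro nn_integral_cong) simp
  then show "(\<integral>\<^sup>+u. ennreal (norm (indicator {0..1} u * pos_power b u)) \<partial>lborel) < \<infinity>" by simp
qed measurable

text \<open>The kernel is the sum of its integrable singularity at \<open>0\<close> and a tail bounded by one.\<close>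

lemma pos_power_le:
  assumes "b > 0"
  shows "pos_power b u \<le> indicator {0..1} u * pos_power b u + 1"
proof (cases "u > 1")
  case True
  then have "u powr (- b) \<le> 1"
    using assms powr_le1[of b u] ge_one_powr_ge_zero[of u b] by (simp add: powr_minus inverse_le_1_iff)
  with True show ?thesis by (simp add: pos_power_def)
qed (auto simp: indicator_def)

text \<open>The value \<open>1 / (1 - b)\<close> is the integral of \<open>u\<^bsup>-b\<^esup>\<close> over \<open>(0, 1)\<close>, and the summand \<open>1\<close> accounts for the
  tail; together they bound the integral of the kernel over \<open>[0, 1]\<close> wherever its singularity lies.\<close>

definition abel_bound :: "real \<Rightarrow> real" where
  "abel_bound b = 1 / (1 - b) + 1"

lemma abel_bound_nonneg: "b < 1 \<Longrightarrow> abel_bound b \<ge> 0"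
  by (simp add: abel_bound_def)

lemma abel_kernel_integral_le:
  assumes "0 < b" "b < 1"
  shows "(\<integral>\<^sup>+y. ennreal (indicator {0..1} y * pos_power b (s - y)) \<partial>lborel) \<le> ennreal (abel_bound b)" (is "?A \<le> _")
    and "(\<integral>\<^sup>+y. ennreal (indicator {0..1} y * pos_power b (y - s)) \<partial>lborel) \<le> ennreal (abel_bound b)" (is "?B \<le> _")
proof -
  define w :: "real \<Rightarrow> real" where "w = (\<lambda>u. indicator {0..1} u * pos_power b u)"
  have [measurable]: "w \<in> borel_measurable borel" unfolding w_def by measurable
  have le: "ennreal (indicator {0..1} y * pos_power b x) \<le> ennreal (w x) + indicator {0..1} y" for x y :: real
    using pos_power_le[OF assms(1), of x]
    by (auto simp: indicator_def w_def ennreal_1[symmetric] ennreal_plus[symmetric] simp del: ennreal_1 ennreal_plus intro!: ennreal_leI)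
  have w: "(\<integral>\<^sup>+u. ennreal (w u) \<partial>lborel) + 1 = ennreal (abel_bound b)"
    unfolding w_def pos_power_nn_integral[OF assms(2)] abel_bound_def using assms
    by (simp add: ennreal_1[symmetric] ennreal_plus[symmetric] del: ennreal_1 ennreal_plus)
  have "?A \<le> (\<integral>\<^sup>+y. ennreal (w (s - y)) + indicator {0..1} y \<partial>lborel)"
    by (intro nn_integral_mono le)
  also have "\<dots> = (\<integral>\<^sup>+y. ennreal (w (s - y)) \<partial>lborel) + 1"
    by (subst nn_integral_add) auto
  also have "(\<integral>\<^sup>+y. ennreal (w (s - y)) \<partial>lborel) = (\<integral>\<^sup>+u. ennreal (w u) \<partial>lborel)"
    using nn_integral_real_affine[of "\<lambda>u. ennreal (w u)" "-1" s] by simp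
  finally show "?A \<le> ennreal (abel_bound b)" unfolding w .
  have "?B \<le> (\<integral>\<^sup>+y. ennreal (w (y - s)) + indicator {0..1} y \<partial>lborel)"
    by (intro nn_integral_mono le)
  also have "\<dots> = (\<integral>\<^sup>+y. ennreal (w (y - s)) \<partial>lborel) + 1"
    by (subst nn_integral_add) auto
  also have "(\<integral>\<^sup>+y. ennreal (w (y - s)) \<partial>lborel) = (\<integral>\<^sup>+u. ennreal (w u) \<partial>lborel)"
    using nn_integral_real_affine[of "\<lambda>u. ennreal (w u)" "1" "-s"] by simp
  finally show "?B \<le> ennreal (abel_bound b)" unfolding w .
qed

lemma abel_bound_weighted:
  assumes b: "0 < b" "b < 1" and g: "\<And>y. \<bar>g y\<bar> \<le> K * indicator {0..1} y"
  shows "(\<integral>\<^sup>+y. ennreal (\<bar>g y\<bar> * pos_power b (s - y)) \<partial>lborel) \<le> ennreal (K * abel_bound b)"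
    and "(\<integral>\<^sup>+y. ennreal (\<bar>g y\<bar> * pos_power b (y - s)) \<partial>lborel) \<le> ennreal (K * abel_bound b)"
proof -
  have K: "K \<ge> 0" using g[of 0] by (simp add: order_trans[OF abs_ge_zero])
  have le: "ennreal (\<bar>g y\<bar> * x) \<le> ennreal K * ennreal (indicator {0..1} y * x)" if "x \<ge> 0" for x y
    using mult_right_mono[OF g that] K that by (simp add: ennreal_mult[symmetric] mult.assoc ennreal_leI)
  have "(\<integral>\<^sup>+y. ennreal (\<bar>g y\<bar> * pos_power b (s - y)) \<partial>lborel)
      \<le> (\<integral>\<^sup>+y. ennreal K * ennreal (indicator {0..1} y * pos_power b (s - y)) \<partial>lborel)"
    by (intro nn_integral_mono le) simp
  also have "\<dots> \<le> ennreal K * ennreal (abel_bound b)"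
    by (subst nn_integral_cmult) (auto intro!: mult_left_mono abel_kernel_integral_le b)
  finally show "(\<integral>\<^sup>+y. ennreal (\<bar>g y\<bar> * pos_power b (s - y)) \<partial>lborel) \<le> ennreal (K * abel_bound b)"
    using K b by (simp add: ennreal_mult abel_bound_nonneg)
  have "(\<integral>\<^sup>+y. ennreal (\<bar>g y\<bar> * pos_power b (y - s)) \<partial>lborel)
      \<le> (\<integral>\<^sup>+y. ennreal K * ennreal (indicator {0..1} y * pos_power b (y - s)) \<partial>lborel)"
    by (intro nn_integral_mono le) simp
  also have "\<dots> \<le> ennreal K * ennreal (abel_bound b)"
    by (subst nn_integral_cmult) (auto intro!: mult_left_mono abel_kernel_integral_le b)
  finally show "(\<integral>\<^sup>+y. ennreal (\<bar>g y\<bar> * pos_power b (y - s)) \<partial>lborel) \<le> ennreal (K * abel_bound b)"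
    using K b by (simp add: ennreal_mult abel_bound_nonneg)
qed

lemma integrable_pos_power_weighted:
  assumes b: "0 < b" "b < 1" and [measurable]: "g \<in> borel_measurable borel"
    and g: "\<And>y. \<bar>g y\<bar> \<le> K * indicator {0..1} y"
  shows "integrable lborel (\<lambda>y. g y * pos_power b (s - y))"
    and "integrable lborel (\<lambda>y. g y * pos_power b (y - s))"
    and "\<bar>\<integral>y. g y * pos_power b (s - y) \<partial>lborel\<bar> \<le> K * abel_bound b"
proof -
  have K: "K \<ge> 0" using g[of 0] by (simp add: order_trans[OF abs_ge_zero])
  show 1: "integrable lborel (\<lambda>y. g y * pos_power b (s - y))" "integrable lborel (\<lambda>y. g y * pos_power b (y - s))"
    using abel_bound_weighted[OF b g, of s]
    by (auto intro!: integrableI_bounded simp: abs_mult intro: le_less_trans)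
  have "ennreal (norm (\<integral>y. g y * pos_power b (s - y) \<partial>lborel)) \<le> ennreal (K * abel_bound b)"
    using order_trans[OF integral_norm_bound_ennreal[OF 1(1)]] abel_bound_weighted(1)[OF b g, of s]
    by (simp add: abs_mult)
  then show "\<bar>\<integral>y. g y * pos_power b (s - y) \<partial>lborel\<bar> \<le> K * abel_bound b"
    using K b abel_bound_nonneg[of b] by (simp add: ennreal_le_iff)
qed

text \<open>The weight \<open>w\<close> is only integrable, since it will itself contain singular factors
  \<open>(s - z)\<^sub>+\<^bsup>-b\<^esup>\<close>. The bound on the inner integral is uniform in \<open>s\<close>, which suffices for
  absolute integrability.\<close>

lemma abel_fubini:
  assumes b: "0 < b" "b < 1"
    and w: "integrable lborel w"
    and [measurable]: "g \<in> borel_measurable borel" and g: "\<And>y. \<bar>g y\<bar> \<le> K * indicator {0..1} y"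
  shows "(\<integral>y. g y * (\<integral>s. w s * pos_power b (s - y) \<partial>lborel) \<partial>lborel)
      = (\<integral>s. w s * (\<integral>y. g y * pos_power b (s - y) \<partial>lborel) \<partial>lborel)" (is "?eq")
    and "integrable lborel (\<lambda>y. g y * (\<integral>s. w s * pos_power b (s - y) \<partial>lborel))" (is "?int")
proof -
  have [measurable]: "w \<in> borel_measurable borel" using w by auto
  have K: "K \<ge> 0" using g[of 0] by (simp add: order_trans[OF abs_ge_zero])
  define J where "J = (\<lambda>s y. g y * (w s * pos_power b (s - y)))"
  have [measurable]: "case_prod J \<in> borel_measurable (lborel \<Otimes>\<^sub>M lborel)"
    unfolding J_def by measurable
  have J: "integrable (lborel \<Otimes>\<^sub>M lborel) (case_prod J)"
  proof (rule integrableI_bounded)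
    have "(\<integral>\<^sup>+z. ennreal (norm (case_prod J z)) \<partial>(lborel \<Otimes>\<^sub>M lborel))
        = (\<integral>\<^sup>+s. \<integral>\<^sup>+y. ennreal (norm (case_prod J (s, y))) \<partial>lborel \<partial>lborel)"
      by (rule lborel.nn_integral_fst[symmetric]) measurable
    also have "\<dots> = (\<integral>\<^sup>+s. ennreal \<bar>w s\<bar> * (\<integral>\<^sup>+y. ennreal (\<bar>g y\<bar> * pos_power b (s - y)) \<partial>lborel) \<partial>lborel)"
      by (subst nn_integral_cmult[symmetric])
        (auto intro!: nn_integral_cong simp: J_def abs_mult ennreal_mult[symmetric] mult_ac)
    also have "\<dots> \<le> (\<integral>\<^sup>+s. ennreal \<bar>w s\<bar> * ennreal (K * abel_bound b) \<partial>lborel)"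
      by (intro nn_integral_mono mult_left_mono abel_bound_weighted[OF b g]) auto
    also have "\<dots> = (\<integral>\<^sup>+s. ennreal \<bar>w s\<bar> \<partial>lborel) * ennreal (K * abel_bound b)"
      by (rule nn_integral_multc) measurable
    also have "\<dots> < \<infinity>"
      using w by (simp add: integrable_iff_bounded ennreal_mult_less_top)
    finally show "(\<integral>\<^sup>+z. ennreal (norm (case_prod J z)) \<partial>(lborel \<Otimes>\<^sub>M lborel)) < \<infinity>" .
  qed measurable
  have "(\<integral>s. w s * (\<integral>y. g y * pos_power b (s - y) \<partial>lborel) \<partial>lborel) = (\<integral>s. \<integral>y. J s y \<partial>lborel \<partial>lborel)"
    unfolding J_def by (subst mult.left_commute) simp
  then show ?eq
    using lborel_pair.Fubini_integral[OF J] by (simp add: J_def)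
  show ?int using lborel_pair.integrable_snd[OF J] by (simp add: J_def)
qed


section \<open>Abel integrals of second differences\<close>

text \<open>This is the value \<open>B(1 + b, 1 - b)\<close> of the Beta function.\<close>

definition abel_beta :: "real \<Rightarrow> real" where
  "abel_beta b = (\<integral>u. pos_power b (1 - u) * pos_power (- b) u \<partial>lborel)"

lemma integral_pos_if_pos_on_interval:
  fixes f :: "real \<Rightarrow> real"
  assumes "integrable lborel f" "\<And>x. f x \<ge> 0" "p < q" "\<And>x. p < x \<Longrightarrow> x < q \<Longrightarrow> f x > 0"
  shows "(\<integral>x. f x \<partial>lborel) > 0"
proof -
  have "(\<integral>x. f x \<partial>lborel) \<noteq> 0"
  proof
    assume "(\<integral>x. f x \<partial>lborel) = 0"
    then have "AE x in lborel. f x = 0"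
      using integral_nonneg_eq_0_iff_AE[OF assms(1)] assms(2) by simp
    then have "AE x in lborel. x \<notin> {p<..<q}"
      by eventually_elim (use assms(4) in force)
    then have "emeasure lborel {p<..<q} = 0"
      by (subst (asm) AE_iff_measurable[of "{p<..<q}"]) auto
    with assms(3) show False by simp
  qed
  moreover have "(\<integral>x. f x \<partial>lborel) \<ge> 0" using assms(2) by simp
  ultimately show ?thesis by simp
qed

lemma abel_beta_integrable:
  assumes "0 < b" "b < 1"
  shows "integrable lborel (\<lambda>u. pos_power b (1 - u) * pos_power (- b) u)"
proof -
  define g where "g = (\<lambda>u. indicator {0..1} u * pos_power (- b) u)"
  have "\<bar>g u\<bar> \<le> 1 * indicator {0..1} u" for u
    using assms by (auto simp: g_def indicator_def pos_power_def powr_le1)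
  moreover have "g \<in> borel_measurable borel" unfolding g_def by measurable
  ultimately have "integrable lborel (\<lambda>u. g u * pos_power b (1 - u))"
    using integrable_pos_power_weighted(1)[OF assms] by blast
  moreover have "g u * pos_power b (1 - u) = pos_power b (1 - u) * pos_power (- b) u" for u
    by (auto simp: g_def indicator_def pos_power_def)
  ultimately show ?thesis by simp
qed

lemma abel_beta_pos:
  assumes "0 < b" "b < 1"
  shows "abel_beta b > 0"
  unfolding abel_beta_def
  by (rule integral_pos_if_pos_on_interval[OF abel_beta_integrable[OF assms], of 0 1]) (auto simp: pos_power_def)

text \<open>Both sides are homogeneous of degree one in \<open>s - p\<close>: the exponents \<open>-b\<close> and \<open>b\<close> cancel, and the
  factor \<open>s - p\<close> is the Jacobian of the substitution \<open>y = p + (s - p) u\<close>.\<close>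

lemma abel_power:
  assumes b: "0 < b" "b < 1"
  shows "integrable lborel (\<lambda>y. pos_power b (s - y) * pos_power (- b) (y - p))" (is "?int")
    and "(\<integral>y. pos_power b (s - y) * pos_power (- b) (y - p) \<partial>lborel) = abel_beta b * max 0 (s - p)" (is "?eq")
proof -
  let ?f = "\<lambda>y. pos_power b (s - y) * pos_power (- b) (y - p)"
  have "?int \<and> ?eq"
  proof (cases "s \<le> p")
    case True
    then have "?f = (\<lambda>y. 0)" by (auto simp: pos_power_def)
    with True show ?thesis by (simp del: mult_eq_0_iff)
  next
    case False
    define t where "t = s - p"
    have t: "t > 0" using False by (simp add: t_def)
    have f: "?f (p + t * u) = pos_power b (1 - u) * pos_power (- b) u" for u
    proof -
      have "s - (p + t * u) = t * (1 - u)" by (simp add: t_def algebra_simps)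
      then have "?f (p + t * u) = (t powr (- b) * t powr b) * (pos_power b (1 - u) * pos_power (- b) u)"
        by (simp add: pos_power_mult[OF t])
      with t show ?thesis by (simp add: powr_add[symmetric])
    qed
    have "integrable lborel (\<lambda>u. ?f (p + t * u))"
      unfolding f by (rule abel_beta_integrable[OF b])
    then have "?int" using lborel_integrable_real_affine_iff[of t ?f p] t by simp
    moreover have "?eq"
      using lborel_integral_real_affine[of t ?f p] t unfolding f by (simp add: abel_beta_def t_def max_def)
    ultimately show ?thesis by simp
  qed
  then show ?int ?eq by auto
qed

text \<open>Second differences of \<open>y\<^sub>+\<^bsup>b\<^esup>\<close> and of \<open>s\<^sub>+\<close>. The second is supported in \<open>[p, q]\<close>, and the Abel
  integral maps the first to a multiple of the second; in this way functions with
  prescribed small support are found in the range of the Abel integral without solving an integral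
  equation.\<close>

definition probe :: "real \<Rightarrow> real \<Rightarrow> real \<Rightarrow> real \<Rightarrow> real" where
  "probe b p q y = pos_power (- b) (y - p) - 2 * pos_power (- b) (y - (p + q) / 2) + pos_power (- b) (y - q)"

definition tent :: "real \<Rightarrow> real \<Rightarrow> real \<Rightarrow> real" where
  "tent p q s = max 0 (s - p) - 2 * max 0 (s - (p + q) / 2) + max 0 (s - q)"

lemma probe_measurable [measurable]: "probe b p q \<in> borel_measurable borel"
  unfolding probe_def[abs_def] by measurable

lemma tent_measurable [measurable]: "tent p q \<in> borel_measurable borel"
  unfolding tent_def[abs_def] by measurable

lemma probe_eq_0: "p < q \<Longrightarrow> y \<le> p \<Longrightarrow> probe b p q y = 0"
  by (simp add: probe_def)

lemma tent_pos: "p < s \<Longrightarrow> s < q \<Longrightarrow> tent p q s > 0"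
  by (auto simp: tent_def max_def field_simps)

lemma tent_eq_0: "p < q \<Longrightarrow> s \<le> p \<or> q \<le> s \<Longrightarrow> tent p q s = 0"
  by (auto simp: tent_def max_def field_simps)

lemma tent_nonneg: "p < q \<Longrightarrow> tent p q s \<ge> 0"
  using tent_pos[of p s q] tent_eq_0[of p q s] by force

lemma tent_le: "p < q \<Longrightarrow> tent p q s \<le> q - p"
  by (auto simp: tent_def max_def field_simps)

lemma tent_reflect: "p < q \<Longrightarrow> tent (- q) (- p) (- r) = tent p q r"
  by (auto simp: tent_def max_def field_simps)

lemma probe_bounded:
  assumes "0 < b" "\<bar>p\<bar> \<le> 1" "\<bar>q\<bar> \<le> 1" "\<bar>y\<bar> \<le> 1"
  shows "\<bar>probe b p q y\<bar> \<le> 4 * 2 powr b"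
proof -
  have "0 \<le> pos_power (- b) (y - x) \<and> pos_power (- b) (y - x) \<le> 2 powr b" if "\<bar>x\<bar> \<le> 1" for x
    using that assms by (auto simp: pos_power_def intro!: powr_mono2)
  note * = this
  have "\<bar>(p + q) / 2\<bar> \<le> 1" using assms by (auto simp: abs_le_iff)
  from *[OF assms(2)] *[OF assms(3)] *[OF this] show ?thesis
    using powr_ge_zero[of 2 b] unfolding probe_def abs_le_iff by linarith
qed

lemma abel_probe:
  assumes b: "0 < b" "b < 1"
  shows "(\<integral>y. pos_power b (s - y) * probe b p q y \<partial>lborel) = abel_beta b * tent p q s"
proof -
  have "(\<integral>y. pos_power b (s - y) * probe b p q y \<partial>lborel)
      = (\<integral>y. pos_power b (s - y) * pos_power (- b) (y - p)
          - 2 * (pos_power b (s - y) * pos_power (- b) (y - (p + q) / 2))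
          + pos_power b (s - y) * pos_power (- b) (y - q) \<partial>lborel)"
    by (intro Bochner_Integration.integral_cong) (auto simp: probe_def algebra_simps)
  also have "\<dots> = abel_beta b * tent p q s"
    using abel_power(1)[OF b, of s] by (simp add: abel_power(2)[OF b] tent_def algebra_simps)
  finally show ?thesis .
qed

lemma abel_probe_reflected:
  assumes b: "0 < b" "b < 1" and "p < q"
  shows "(\<integral>s. pos_power b (s - r) * probe b (- q) (- p) (- s) \<partial>lborel) = abel_beta b * tent p q r"
proof -
  have eq: "- s - r = - r - s" for s :: real by simp
  have "(\<integral>s. pos_power b (s - r) * probe b (- q) (- p) (- s) \<partial>lborel)
      = (\<integral>s. pos_power b (- r - s) * probe b (- q) (- p) s \<partial>lborel)"
    using lborel_integral_real_affine[of "-1" "\<lambda>s. pos_power b (s - r) * probe b (- q) (- p) (- s)" 0]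
    by (simp add: eq)
  then show ?thesis
    by (simp add: abel_probe[OF b] tent_reflect[OF \<open>p < q\<close>])
qed


section \<open>The Abel transform of a test function\<close>

definition abel_transform :: "real \<Rightarrow> (real \<Rightarrow> real) \<Rightarrow> real \<Rightarrow> real" where
  "abel_transform b h s = (\<integral>r. h r * pos_power b (s - r) \<partial>lborel)"

lemma continuous_on_nonzero_interval:
  fixes f :: "real \<Rightarrow> real"
  assumes "continuous_on {0<..<1} f" "0 < x" "x < 1" "f x \<noteq> 0"
  obtains p q where "0 < p" "p < q" "q < 1" "\<And>y. p \<le> y \<Longrightarrow> y \<le> q \<Longrightarrow> f x * f y > 0"
proof -
  define U where "U = {0<..<1} \<inter> (\<lambda>y. f x * f y) -` {0<..}"
  have "open U" unfolding U_def
    by (intro continuous_open_preimage continuous_intros assms(1))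
  moreover have "x \<in> U" using assms by (simp add: U_def mult_neg_neg not_square_less_zero power2_eq_square[symmetric] zero_less_mult_iff linorder_neq_iff)
  ultimately obtain e where e: "e > 0" "cball x e \<subseteq> U"
    using open_contains_cball by blast
  then have "{x - e..x + e} \<subseteq> U" by (simp add: cball_eq_atLeastAtMost)
  moreover from this have "x - e \<in> U" "x + e \<in> U" using e by auto
  ultimately show ?thesis
    using e by (intro that[of "x - e" "x + e"]) (auto simp: U_def)
qed

text \<open>After the translation \<open>u = s - r\<close> the dependence on \<open>s\<close> sits in the continuous factor \<open>h (s - u)\<close>, and
  dominated convergence applies.\<close>

lemma abel_transform_continuous:
  assumes b: "b < 1"
    and h: "continuous_on UNIV h" "\<And>r. \<bar>h r\<bar> \<le> K" "{r. h r \<noteq> 0} \<subseteq> {0<..<1}"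
  shows "continuous_on {0<..<1} (abel_transform b h)"
proof -
  have supp: "h r = 0" if "r \<notin> {0<..<1}" for r using h(3) that by blast
  define w :: "real \<Rightarrow> real" where "w = (\<lambda>u. indicator {0..1} u * pos_power b u)"
  have w: "integrable lborel w" unfolding w_def by (rule pos_power_integrable[OF b])
  then have [measurable]: "w \<in> borel_measurable borel" by auto
  have [measurable]: "h \<in> borel_measurable borel" by (rule borel_measurable_continuous_onI[OF h(1)])
  have eq: "abel_transform b h s = (\<integral>u. h (s - u) * w u \<partial>lborel)" if "s \<le> 1" for s
  proof -
    have "abel_transform b h s = (\<integral>u. h (s - u) * pos_power b u \<partial>lborel)"
      using lborel_integral_real_affine[of "-1" "\<lambda>r. h r * pos_power b (s - r)" s]
      by (simp add: abel_transform_def)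
    also have "\<dots> = (\<integral>u. h (s - u) * w u \<partial>lborel)"
      using that supp by (intro Bochner_Integration.integral_cong) (auto simp: w_def indicator_def pos_power_def)
    finally show ?thesis .
  qed
  have "continuous_on UNIV (\<lambda>s. \<integral>u. h (s - u) * w u \<partial>lborel)"
    unfolding continuous_on_eq_continuous_at[OF open_UNIV] continuous_at_sequentially comp_def
  proof (intro ballI allI impI)
    fix s :: real and x :: "nat \<Rightarrow> real" assume x: "x \<longlonglongrightarrow> s"
    show "(\<lambda>n. \<integral>u. h (x n - u) * w u \<partial>lborel) \<longlonglongrightarrow> (\<integral>u. h (s - u) * w u \<partial>lborel)"
    proof (rule integral_dominated_convergence[where w="\<lambda>u. K * \<bar>w u\<bar>"])
      show "integrable lborel (\<lambda>u. K * \<bar>w u\<bar>)" using w by simp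
      show "AE u in lborel. norm (h (x n - u) * w u) \<le> K * \<bar>w u\<bar>" for n
        using h(2) by (auto simp: abs_mult intro!: mult_right_mono)
      have "isCont h y" for y using h(1) by (simp add: continuous_on_eq_continuous_at)
      then show "AE u in lborel. (\<lambda>n. h (x n - u) * w u) \<longlonglongrightarrow> h (s - u) * w u"
        by (auto intro!: tendsto_intros isCont_tendsto_compose[of _ h] x)
    qed measurable
  qed
  then have "continuous_on {0<..<1} (\<lambda>s. \<integral>u. h (s - u) * w u \<partial>lborel)"
    by (rule continuous_on_subset) simp
  then show ?thesis
    by (rule continuous_on_eq) (use eq in simp)
qed

lemma integrable_unit_interval_bounded:
  fixes g :: "real \<Rightarrow> real"
  assumes [measurable]: "g \<in> borel_measurable borel" and g: "\<And>y. \<bar>g y\<bar> \<le> K * indicator {0..1} y"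
  shows "integrable lborel g"
proof (rule Bochner_Integration.integrable_bound)
  show "integrable lborel (\<lambda>y::real. K * indicator {0..1} y)"
    by (intro integrable_mult_right integrable_real_indicator) auto
  show "AE y in lborel. norm (g y) \<le> norm (K * indicator {0..1} y)"
    using order_trans[OF g abs_ge_self] by simp
qed measurable

text \<open>Injectivity of the Abel integral on continuous functions supported in \<open>(0, 1)\<close>. By Fubini and the reflected
  form of the second difference formula, the integral of the transform against a reflected probe is
  a positive multiple of \<open>\<integral> h \<cdot> tent\<close>. This is nonzero if the tent stands on an interval on
  which \<open>h\<close> has constant sign.\<close>

lemma abel_transform_nonzero:
  assumes b: "0 < b" "b < 1"
    and h: "continuous_on UNIV h" "\<And>r. \<bar>h r\<bar> \<le> K" "{r. h r \<noteq> 0} \<subseteq> {0<..<1}"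
    and "h \<noteq> (\<lambda>_. 0)"
  shows "\<exists>s. 0 < s \<and> s < 1 \<and> abel_transform b h s \<noteq> 0"
proof (rule ccontr)
  assume *: "\<not> ?thesis"
  have supp: "h r = 0" if "r \<notin> {0<..<1}" for r using h(3) that by blast
  have [measurable]: "h \<in> borel_measurable borel" by (rule borel_measurable_continuous_onI[OF h(1)])
  obtain x where x: "h x \<noteq> 0" using \<open>h \<noteq> (\<lambda>_. 0)\<close> by auto
  then have "0 < x" "x < 1" using supp[of x] by auto
  then obtain p q where pq: "0 < p" "p < q" "q < 1" "\<And>y. p \<le> y \<Longrightarrow> y \<le> q \<Longrightarrow> h x * h y > 0"
    using continuous_on_nonzero_interval[OF continuous_on_subset[OF h(1)], of x] x by blast
  define w where "w = (\<lambda>s. indicator {0<..<1} s * probe b (- q) (- p) (- s))"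
  have [measurable]: "w \<in> borel_measurable borel" unfolding w_def by measurable
  have hK: "\<bar>h r\<bar> \<le> K * indicator {0..1} r" for r
    using h(2)[of r] supp[of r] by (auto simp: indicator_def)
  have "integrable lborel w"
  proof (rule integrable_unit_interval_bounded)
    show "\<bar>w s\<bar> \<le> 4 * 2 powr b * indicator {0..1} s" for s
      using probe_bounded[of b "- q" "- p" "- s"] b pq by (auto simp: w_def indicator_def)
  qed measurable
  note fubini = abel_fubini(1)[OF b this _ hK]
  have inner: "h r * (\<integral>s. w s * pos_power b (s - r) \<partial>lborel) = abel_beta b * (h r * tent p q r)" for r
  proof (cases "r \<in> {0<..<1}")
    case True
    have "w s * pos_power b (s - r) = pos_power b (s - r) * probe b (- q) (- p) (- s)" for s
      using True pq by (cases "s \<le> r") (auto simp: w_def indicator_def probe_eq_0)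
    then have "(\<integral>s. w s * pos_power b (s - r) \<partial>lborel) = abel_beta b * tent p q r"
      by (simp only: abel_probe_reflected[OF b pq(2), of r])
    then show ?thesis by simp
  qed (use supp in simp)
  have "(\<integral>s. w s * abel_transform b h s \<partial>lborel) = (\<integral>s. 0 \<partial>(lborel :: real measure))"
    by (intro Bochner_Integration.integral_cong) (use * in \<open>auto simp: w_def indicator_def\<close>)
  then have "(\<integral>r. h r * tent p q r \<partial>lborel) = 0"
    using fubini abel_beta_pos[OF b] by (simp add: inner abel_transform_def)
  then have "(\<integral>r. h x * (h r * tent p q r) \<partial>lborel) = 0" by simp
  moreover have "(\<integral>r. h x * (h r * tent p q r) \<partial>lborel) > 0"
  proof (rule integral_pos_if_pos_on_interval[OF _ _ pq(2)])
    have "integrable lborel (\<lambda>r. h r * tent p q r)"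
    proof (rule integrable_unit_interval_bounded)
      show "\<bar>h r * tent p q r\<bar> \<le> (K * (q - p)) * indicator {0..1} r" for r
        using mult_mono[OF h(2)[of r] tent_le[OF pq(2), of r]] tent_nonneg[OF pq(2), of r] h(2)[of r] supp[of r]
        by (auto simp: abs_mult indicator_def intro: order_trans[OF abs_ge_zero])
    qed measurable
    then show "integrable lborel (\<lambda>r. h x * (h r * tent p q r))" by simp
    show "0 < h x * (h r * tent p q r)" if "p < r" "r < q" for r
      using mult_pos_pos[OF pq(4)[of r] tent_pos[OF that]] that by (simp add: mult.assoc)
    then show "0 \<le> h x * (h r * tent p q r)" for r
      using tent_eq_0[OF pq(2), of r] by (cases "p < r \<and> r < q") (auto simp: less_imp_le)
  qed
  ultimately show False by (simp only: less_irrefl)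
qed


section \<open>Infinite rank of Abel kernels\<close>

lemma kernel_rank_infiniteI:
  assumes "\<And>n::nat. \<exists>g. (\<forall>i<n. g i \<in> L2 lborel) \<and>
     (\<forall>c. (AE y in lborel. (\<Sum>i<n. c i * kernel_operator k (g i) y) = 0) \<longrightarrow> (\<forall>i<n. c i = 0))"
  shows "kernel_rank k = \<infinity>"
proof (cases "kernel_rank k")
  case (enat m)
  have "enat (Suc m) \<le> kernel_rank k"
    unfolding kernel_rank_def by (rule Sup_upper) (use assms[of "Suc m"] in blast)
  with enat show ?thesis by simp
qed

lemma L2_unit_interval_bounded:
  fixes g :: "real \<Rightarrow> real"
  assumes [measurable]: "g \<in> borel_measurable borel" and g: "\<And>y. \<bar>g y\<bar> \<le> K * indicator {0..1} y"
  shows "g \<in> L2 lborel"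
proof (rule L2_I)
  show "integrable lborel (\<lambda>y. (g y)\<^sup>2)"
  proof (rule integrable_unit_interval_bounded)
    show "\<bar>(g y)\<^sup>2\<bar> \<le> K\<^sup>2 * indicator {0..1} y" for y
      using power_mono[OF g[of y], of 2] by (auto simp: indicator_def split: if_splits)
  qed measurable
qed simp

text \<open>The operator factors as \<open>c T\<^sup>* M\<^sub>a T\<close>, with \<open>T\<close> the Abel integral and \<open>M\<^sub>a\<close> the multiplication by \<open>a\<close>.
  Here the factorisation appears as a formula for the bilinear form, obtained from two applications of
  Fubini, one in \<open>(s, z)\<close> for fixed \<open>y\<close> and one in \<open>(s, y)\<close>. Both rest on the
  bound for \<open>T g\<close> that holds uniformly in \<open>s\<close>.\<close>

lemma abel_form:
  fixes c :: real
  assumes b: "0 < b" "b < 1"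
    and a [measurable]: "a \<in> borel_measurable borel" and a_le: "\<And>s. \<bar>a s\<bar> \<le> K * indicator {0..1} s"
    and g [measurable]: "g \<in> borel_measurable borel" and g_le: "\<And>y. \<bar>g y\<bar> \<le> L * indicator {0..1} y"
    and g' [measurable]: "g' \<in> borel_measurable borel" and g'_le: "\<And>y. \<bar>g' y\<bar> \<le> L' * indicator {0..1} y"
    and k: "\<And>y z. k y z = c * (\<integral>s. a s * pos_power b (s - y) * pos_power b (s - z) \<partial>lborel)"
  shows "integrable lborel (\<lambda>y. g' y * kernel_operator k g y)"
    and "(\<integral>y. g' y * kernel_operator k g y \<partial>lborel)
      = c * (\<integral>s. a s * (\<integral>z. g z * pos_power b (s - z) \<partial>lborel) * (\<integral>y. g' y * pos_power b (s - y) \<partial>lborel) \<partial>lborel)"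
proof -
  define Tg where "Tg s = (\<integral>z. g z * pos_power b (s - z) \<partial>lborel)" for s
  have [measurable]: "Tg \<in> borel_measurable borel" unfolding Tg_def[abs_def] by measurable
  have L: "L \<ge> 0" using g_le[of 0] by (simp add: order_trans[OF abs_ge_zero])
  have "kernel_operator k g y = c * (\<integral>s. (a s * Tg s) * pos_power b (s - y) \<partial>lborel)" for y
  proof -
    have "kernel_operator k g y
        = c * (\<integral>z. g z * (\<integral>s. (a s * pos_power b (s - y)) * pos_power b (s - z) \<partial>lborel) \<partial>lborel)"
      unfolding kernel_operator_def k by (subst integral_mult_right_zero[symmetric]) (simp only: mult_ac)
    also have "\<dots> = c * (\<integral>s. (a s * pos_power b (s - y)) * Tg s \<partial>lborel)"
      unfolding Tg_def
      by (subst abel_fubini(1)[OF b integrable_pos_power_weighted(2)[OF b a a_le] g g_le]) (rule refl)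
    finally show ?thesis by (simp only: mult_ac)
  qed
  moreover have aT: "integrable lborel (\<lambda>s. a s * Tg s)"
  proof (rule integrable_unit_interval_bounded)
    show "\<bar>a s * Tg s\<bar> \<le> (K * (L * abel_bound b)) * indicator {0..1} s" for s
    proof -
      have "\<bar>a s\<bar> * \<bar>Tg s\<bar> \<le> (K * indicator {0..1} s) * (L * abel_bound b)"
        unfolding Tg_def using a_le[of s]
        by (intro mult_mono integrable_pos_power_weighted(3)[OF b g g_le]) (auto intro: order_trans[OF abs_ge_zero])
      then show ?thesis by (simp add: abs_mult mult_ac)
    qed
  qed measurable
  ultimately have eq: "g' y * kernel_operator k g y = c * (g' y * (\<integral>s. (a s * Tg s) * pos_power b (s - y) \<partial>lborel))" for y
    by (simp only: mult_ac)
  show "integrable lborel (\<lambda>y. g' y * kernel_operator k g y)"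
    unfolding eq by (intro integrable_mult_right abel_fubini(2)[OF b aT g' g'_le])
  show "(\<integral>y. g' y * kernel_operator k g y \<partial>lborel)
      = c * (\<integral>s. a s * (\<integral>z. g z * pos_power b (s - z) \<partial>lborel) * (\<integral>y. g' y * pos_power b (s - y) \<partial>lborel) \<partial>lborel)"
    unfolding eq by (simp only: integral_mult_right_zero abel_fubini(1)[OF b aT g' g'_le]) (simp only: Tg_def)
qed

lemma tents_disjoint:
  assumes "p < q" "q \<le> p'" "p' < q'"
  shows "tent p q s * tent p' q' s = 0"
  using tent_eq_0[of p q s] tent_eq_0[of p' q' s] assms by (cases "s \<le> p'") auto

text \<open>An interval on which \<open>a\<close> has constant sign is cut into \<open>n\<close> pieces. The probes on these pieces are
  mapped by \<open>T\<close> to tents with disjoint interiors of their supports, so that the matrix of the bilinear form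
  on the \<open>n\<close> probes is diagonal, and its diagonal entries \<open>c \<integral> a \<cdot> tent\<^sup>2\<close> do not vanish. Hence the
  images of the probes are linearly independent.\<close>

theorem abel_kernel_rank:
  fixes c :: real
  assumes b: "0 < b" "b < 1" and c: "c \<noteq> 0"
    and cont: "continuous_on {0<..<1} a" and K: "\<And>s. 0 < s \<Longrightarrow> s < 1 \<Longrightarrow> \<bar>a s\<bar> \<le> K"
    and s0: "0 < s0" "s0 < 1" "a s0 \<noteq> 0"
    and k: "\<And>y z. k y z = c * (LBINT s:{0<..<1}. a s * pos_power b (s - y) * pos_power b (s - z))"
  shows "kernel_rank k = \<infinity>"
proof (rule kernel_rank_infiniteI)
  fix n :: nat
  obtain p q where pq: "0 < p" "p < q" "q < 1" "\<And>y. p \<le> y \<Longrightarrow> y \<le> q \<Longrightarrow> a s0 * a y > 0"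
    using continuous_on_nonzero_interval[OF cont s0] by blast
  define A where "A = (\<lambda>s. indicator {0<..<1} s *\<^sub>R a s)"
  have A [measurable]: "A \<in> borel_measurable borel"
    unfolding A_def by (rule borel_measurable_continuous_on_indicator[OF _ cont]) simp
  have A_le: "\<bar>A s\<bar> \<le> K * indicator {0..1} s" for s
    using K[of s] order_trans[OF abs_ge_zero K[OF s0(1,2)]] by (auto simp: A_def indicator_def)
  have kA: "k y z = c * (\<integral>s. A s * pos_power b (s - y) * pos_power b (s - z) \<partial>lborel)" for y z
    unfolding k set_lebesgue_integral_def A_def by (simp add: mult.assoc)
  define x where "x i = p + real i * ((q - p) / real n)" for i
  have x_less: "x i < x (Suc i)" if "i < n" for i
    using that pq(2) by (auto simp: x_def distrib_right intro!: divide_strict_right_mono)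
  have x_mono: "x i \<le> x j" if "i \<le> j" for i j
    using that pq(2) by (auto simp: x_def intro!: divide_right_mono mult_right_mono)
  have x_n: "x n = q" if "n > 0" using that by (simp add: x_def)
  have x_ge: "p \<le> x i" for i using pq(2) by (simp add: x_def)
  have x_le: "x i \<le> q" if "i \<le> n" "n > 0" for i using x_mono[OF that(1)] x_n[OF that(2)] by simp
  define g where "g i y = indicator {0..1} y * probe b (x i) (x (Suc i)) y" for i y
  have g [measurable]: "g i \<in> borel_measurable borel" for i unfolding g_def[abs_def] by measurable
  have g_le: "\<bar>g i y\<bar> \<le> (4 * 2 powr b) * indicator {0..1} y" if "i < n" for i y
    using probe_bounded[OF b(1), of "x i" "x (Suc i)" y] x_ge[of i] x_ge[of "Suc i"] x_le[of i] x_le[of "Suc i"] that pq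
    by (auto simp: g_def indicator_def)
  have Tg: "(\<integral>y. g i y * pos_power b (s - y) \<partial>lborel) = abel_beta b * tent (x i) (x (Suc i)) s"
    if "i < n" "s < 1" for i s
  proof -
    \<comment> \<open>The cut-off of the probe to the unit interval is invisible for s < 1: the probe vanishes to
      the left of x i > 0, and the kernel vanishes for y > s.\<close>
    have "g i y * pos_power b (s - y) = pos_power b (s - y) * probe b (x i) (x (Suc i)) y" for y
      using probe_eq_0[OF x_less[OF that(1)], of y b] that(2) x_ge[of i] pq(1)
      by (cases "s \<le> y"; cases "y \<le> x i") (simp_all add: g_def indicator_def)
    then show ?thesis by (simp only: abel_probe[OF b])
  qed
  define W where "W i j = (\<integral>s. A s * (tent (x i) (x (Suc i)) s * tent (x j) (x (Suc j)) s) \<partial>lborel)" for i j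
  have form: "(\<integral>y. g j y * kernel_operator k (g i) y \<partial>lborel) = c * (abel_beta b)\<^sup>2 * W i j" if "i < n" "j < n" for i j
  proof -
    have eq: "A s * (\<integral>z. g i z * pos_power b (s - z) \<partial>lborel) * (\<integral>y. g j y * pos_power b (s - y) \<partial>lborel)
        = (abel_beta b)\<^sup>2 * (A s * (tent (x i) (x (Suc i)) s * tent (x j) (x (Suc j)) s))" for s
      using that by (cases "s < 1") (auto simp: Tg A_def power2_eq_square)
    show ?thesis
      unfolding abel_form(2)[OF b A A_le g g_le[OF that(1)] g g_le[OF that(2)] kA] W_def eq
      by (simp only: integral_mult_right_zero mult.assoc)
  qed
  have W0: "W i j = 0" if "i < n" "j < n" "i \<noteq> j" for i j
  proof -
    have eq: "tent (x i) (x (Suc i)) s * tent (x j) (x (Suc j)) s = 0" for s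
    proof (cases "i < j")
      case True
      then show ?thesis by (intro tents_disjoint x_less x_mono) (use that in auto)
    next
      case False
      with that have "tent (x j) (x (Suc j)) s * tent (x i) (x (Suc i)) s = 0"
        by (intro tents_disjoint x_less x_mono) auto
      then show ?thesis by (simp only: mult.commute)
    qed
    show ?thesis unfolding W_def eq by simp
  qed
  have W_nz: "W i i \<noteq> 0" if "i < n" for i
  proof -
    let ?t = "tent (x i) (x (Suc i))"
    note xi = x_less[OF that]
    have "a s0 * W i i = (\<integral>s. a s0 * (A s * (?t s * ?t s)) \<partial>lborel)"
      by (simp add: W_def)
    also have "\<dots> > 0"
    proof (rule integral_pos_if_pos_on_interval[OF _ _ xi])
      have "integrable lborel (\<lambda>s. A s * (?t s * ?t s))"
      proof (rule integrable_unit_interval_bounded)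
        show "\<bar>A s * (?t s * ?t s)\<bar> \<le> (K * ((x (Suc i) - x i) * (x (Suc i) - x i))) * indicator {0..1} s" for s
        proof -
          have "\<bar>A s\<bar> * (?t s * ?t s) \<le> (K * indicator {0..1} s) * ((x (Suc i) - x i) * (x (Suc i) - x i))"
            using A_le[of s] tent_nonneg[OF xi, of s] tent_le[OF xi, of s] xi
            by (intro mult_mono) (auto intro: order_trans[OF abs_ge_zero])
          then show ?thesis by (simp add: abs_mult mult_ac)
        qed
      qed measurable
      then show "integrable lborel (\<lambda>s. a s0 * (A s * (?t s * ?t s)))" by simp
      show pos: "0 < a s0 * (A s * (?t s * ?t s))" if s: "x i < s" "s < x (Suc i)" for s
      proof -
        have "p \<le> s" "s \<le> q" using s x_ge[of i] x_le[of "Suc i"] \<open>i < n\<close> by auto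
        with pq have aA: "0 < a s0 * A s" by (simp add: A_def)
        have "0 < (a s0 * A s) * (?t s * ?t s)"
          by (rule mult_pos_pos[OF aA mult_pos_pos[OF tent_pos[OF s] tent_pos[OF s]]])
        then show ?thesis by (simp only: mult.assoc)
      qed
      show "0 \<le> a s0 * (A s * (?t s * ?t s))" for s
        using pos[of s] tent_eq_0[OF xi, of s] by (cases "x i < s \<and> s < x (Suc i)") (auto simp: less_imp_le)
    qed
    finally show ?thesis by auto
  qed
  show "\<exists>g. (\<forall>i<n. g i \<in> L2 lborel) \<and>
     (\<forall>c. (AE y in lborel. (\<Sum>i<n. c i * kernel_operator k (g i) y) = 0) \<longrightarrow> (\<forall>i<n. c i = 0))"
  proof (intro exI[of _ g] conjI allI impI)
    show "g i \<in> L2 lborel" if "i < n" for i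
      by (rule L2_unit_interval_bounded[OF g g_le[OF that]])
    fix d :: "nat \<Rightarrow> real" and j
    assume ae: "AE y in lborel. (\<Sum>i<n. d i * kernel_operator k (g i) y) = 0" and j: "j < n"
    have int: "integrable lborel (\<lambda>y. d i * (g j y * kernel_operator k (g i) y))" if "i < n" for i
      by (intro integrable_mult_right abel_form(1)[OF b A A_le g g_le[OF that] g g_le[OF j] kA])
    have "0 = (\<integral>y. (\<Sum>i<n. d i * (g j y * kernel_operator k (g i) y)) \<partial>lborel)"
    proof (rule integral_eq_zero_AE[symmetric])
      have eq: "(\<Sum>i<n. d i * (g j y * kernel_operator k (g i) y)) = g j y * (\<Sum>i<n. d i * kernel_operator k (g i) y)" for y
        by (simp add: sum_distrib_left mult_ac)
      show "AE y in lborel. (\<Sum>i<n. d i * (g j y * kernel_operator k (g i) y)) = 0"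
        using ae by eventually_elim (simp add: eq)
    qed
    also have "\<dots> = (\<Sum>i<n. d i * (c * (abel_beta b)\<^sup>2 * W i j))"
      using int by (subst Bochner_Integration.integral_sum) (auto simp: form j intro!: sum.cong)
    also have "\<dots> = d j * (c * (abel_beta b)\<^sup>2 * W j j)"
      using j by (subst sum.remove[of _ j]) (auto simp: W0 intro!: sum.neutral)
    finally show "d j = 0"
      using W_nz[OF j] c abel_beta_pos[OF b] by simp
  qed
qed


section \<open>Kernels on the plane\<close>

lemma nn_integral_lebesgue_power2:
  assumes f [measurable]: "f \<in> borel_measurable (lebesgue_power 2)"
  shows "(\<integral>\<^sup>+x. f x \<partial>lebesgue_power 2)
    = (\<integral>\<^sup>+y. \<integral>\<^sup>+z. f (\<lambda>i\<in>{..<2}. if i = 0 then y else z) \<partial>lborel \<partial>lborel)"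
proof -
  have I: "{..<2::nat} = insert 1 {0}" by auto
  have T [measurable]: "(\<lambda>(y, z). (\<lambda>i\<in>{..<2::nat}. if i = 0 then y else z)) \<in> lborel \<Otimes>\<^sub>M lborel \<rightarrow>\<^sub>M lebesgue_power 2"
    unfolding case_prod_unfold by (rule measurable_restrict) simp
  have "(\<integral>\<^sup>+x. f x \<partial>lebesgue_power 2)
      = (\<integral>\<^sup>+x. (\<integral>\<^sup>+z. f (x(1 := z)) \<partial>lborel) \<partial>Pi\<^sub>M {0::nat} (\<lambda>_. lborel))"
    using f unfolding I by (intro lborel_power.product_nn_integral_insert) auto
  also have "\<dots> = (\<integral>\<^sup>+x. (\<integral>\<^sup>+z. f (\<lambda>i\<in>{..<2}. if i = 0 then x 0 else z) \<partial>lborel) \<partial>Pi\<^sub>M {0::nat} (\<lambda>_. lborel))"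
  proof (rule nn_integral_cong)
    fix x :: "nat \<Rightarrow> real" assume "x \<in> space (Pi\<^sub>M {0::nat} (\<lambda>_. lborel))"
    then have "x(1 := z) = (\<lambda>i\<in>{..<2}. if i = 0 then x 0 else z)" for z
      by (auto simp: fun_eq_iff space_PiM PiE_def extensional_def)
    then show "(\<integral>\<^sup>+z. f (x(1 := z)) \<partial>lborel) = (\<integral>\<^sup>+z. f (\<lambda>i\<in>{..<2}. if i = 0 then x 0 else z) \<partial>lborel)"
      by simp
  qed
  also have "\<dots> = (\<integral>\<^sup>+y. \<integral>\<^sup>+z. f (\<lambda>i\<in>{..<2}. if i = 0 then y else z) \<partial>lborel \<partial>lborel)"
  proof (rule lborel_power.product_nn_integral_singleton)
    have "(\<lambda>(y, z). f (\<lambda>i\<in>{..<2}. if i = 0 then y else z)) \<in> borel_measurable (lborel \<Otimes>\<^sub>M lborel)"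
      using measurable_compose[OF T f] by (simp add: case_prod_unfold)
    then show "(\<lambda>y. \<integral>\<^sup>+z. f (\<lambda>i\<in>{..<2}. if i = 0 then y else z) \<partial>lborel) \<in> borel_measurable lborel"
      by (rule lborel.borel_measurable_nn_integral)
  qed
  finally show ?thesis .
qed

lemma AE_lebesgue_power2:
  assumes "AE x in lebesgue_power 2. P (x 0) (x 1)"
  shows "AE y in lborel. AE z in lborel. P y z"
proof -
  obtain N where N: "N \<in> sets (lebesgue_power 2)" "emeasure (lebesgue_power 2) N = 0"
    "{x \<in> space (lebesgue_power 2). \<not> P (x 0) (x 1)} \<subseteq> N"
    using assms by (auto elim: AE_E)
  define F :: "real \<Rightarrow> real \<Rightarrow> ennreal" where "F y z = indicator N (\<lambda>i\<in>{..<2}. if i = 0 then y else z)" for y z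
  have T: "(\<lambda>(y, z). (\<lambda>i\<in>{..<2::nat}. if i = 0 then y else z)) \<in> lborel \<Otimes>\<^sub>M lborel \<rightarrow>\<^sub>M lebesgue_power 2"
    unfolding case_prod_unfold by (rule measurable_restrict) simp
  have [measurable]: "case_prod F \<in> borel_measurable (lborel \<Otimes>\<^sub>M lborel)"
    using measurable_compose[OF T borel_measurable_indicator[OF N(1)]] by (simp add: F_def case_prod_unfold)
  have "(\<integral>\<^sup>+y. \<integral>\<^sup>+z. F y z \<partial>lborel \<partial>lborel) = 0"
    using nn_integral_lebesgue_power2[of "indicator N"] N(1,2) by (simp add: F_def)
  then have "AE y in lborel. (\<integral>\<^sup>+z. F y z \<partial>lborel) = 0"
    by (subst (asm) nn_integral_0_iff_AE) auto
  then show ?thesis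
  proof eventually_elim
    case (elim y)
    have "(\<lambda>z. F y z) \<in> borel_measurable lborel" by measurable
    with elim have "AE z in lborel. F y z = 0"
      by (simp add: nn_integral_0_iff_AE)
    then show ?case
    proof eventually_elim
      case (elim z)
      then have "(\<lambda>i\<in>{..<2::nat}. if i = 0 then y else z) \<notin> N"
        by (simp add: F_def indicator_def split: if_splits)
      moreover have "(\<lambda>i\<in>{..<2::nat}. if i = 0 then y else z) \<in> space (lebesgue_power 2)"
        by (simp add: space_PiM)
      ultimately have "P ((\<lambda>i\<in>{..<2::nat}. if i = 0 then y else z) 0) ((\<lambda>i\<in>{..<2::nat}. if i = 0 then y else z) 1)"
        using N(3) by blast
      then show ?case by simp
    qed
  qed
qed

lemma AE_off_diagonal: "AE x in lebesgue_power 2. x 0 \<noteq> x 1"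
proof -
  let ?D = "{x \<in> space (lebesgue_power 2). x 0 = x 1}"
  have [measurable]: "?D \<in> sets (lebesgue_power 2)" by measurable
  have "emeasure (lebesgue_power 2) ?D = (\<integral>\<^sup>+x. indicator ?D x \<partial>lebesgue_power 2)" by simp
  also have "\<dots> = (\<integral>\<^sup>+y. \<integral>\<^sup>+z. indicator {y} z \<partial>lborel \<partial>(lborel :: real measure))"
  proof -
    have "indicator ?D (\<lambda>i\<in>{..<2}. if i = 0 then y else z) = (indicator {y} z :: ennreal)" for y z
      by (auto simp: indicator_def space_PiM)
    then show ?thesis
      using nn_integral_lebesgue_power2[of "indicator ?D"] by simp
  qed
  also have "\<dots> = 0" by simp
  finally show ?thesis
    by (intro AE_I[of _ _ ?D]) auto
qed

lemma kernel2_section_measurable: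
  assumes "kernel2 k \<in> borel_measurable (lebesgue_power 2)"
  shows "k y \<in> borel_measurable lborel"
proof -
  have T: "(\<lambda>z. (\<lambda>i\<in>{..<2::nat}. if i = 0 then y else z)) \<in> lborel \<rightarrow>\<^sub>M lebesgue_power 2"
    by (rule measurable_restrict) simp
  have "(\<lambda>z. kernel2 k (\<lambda>i\<in>{..<2}. if i = 0 then y else z)) \<in> borel_measurable lborel"
    by (rule measurable_compose[OF T assms])
  then show ?thesis by (simp add: kernel2_def)
qed

lemma kernel_rank_cong_AE:
  assumes k: "kernel2 k \<in> borel_measurable (lebesgue_power 2)" and k': "kernel2 k' \<in> borel_measurable (lebesgue_power 2)"
    and ae: "AE x in lebesgue_power 2. kernel2 k x = kernel2 k' x"
  shows "kernel_rank k = kernel_rank k'"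
proof -
  have "AE y in lborel. AE z in lborel. k y z = k' y z"
    by (rule AE_lebesgue_power2) (use ae in \<open>simp add: kernel2_def\<close>)
  then have op: "AE y in lborel. \<forall>g\<in>L2 lborel. kernel_operator k g y = kernel_operator k' g y"
  proof eventually_elim
    case (elim y)
    note [measurable] = kernel2_section_measurable[OF k, of y] kernel2_section_measurable[OF k', of y]
    show ?case
    proof
      fix g :: "real \<Rightarrow> real" assume "g \<in> L2 lborel"
      then have [measurable]: "g \<in> borel_measurable lborel" by (rule L2_measurable)
      show "kernel_operator k g y = kernel_operator k' g y"
        unfolding kernel_operator_def
      proof (rule integral_cong_AE)
        show "AE z in lborel. k y z * g z = k' y z * g z"
          using elim by eventually_elim simp
      qed measurable
    qed
  qed
  have "(AE y in lborel. (\<Sum>i<n. c i * kernel_operator k (g i) y) = 0)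
      \<longleftrightarrow> (AE y in lborel. (\<Sum>i<n. c i * kernel_operator k' (g i) y) = 0)"
    if "\<forall>i<n. g i \<in> L2 lborel" for n :: nat and c g
  proof -
    have "AE y in lborel. (\<Sum>i<n. c i * kernel_operator k (g i) y) = (\<Sum>i<n. c i * kernel_operator k' (g i) y)"
      using op by eventually_elim (use that in \<open>auto intro!: sum.cong\<close>)
    note eq = this
    show ?thesis
    proof
      assume "AE y in lborel. (\<Sum>i<n. c i * kernel_operator k (g i) y) = 0"
      with eq show "AE y in lborel. (\<Sum>i<n. c i * kernel_operator k' (g i) y) = 0"
        by eventually_elim simp
    next
      assume "AE y in lborel. (\<Sum>i<n. c i * kernel_operator k' (g i) y) = 0"
      with eq show "AE y in lborel. (\<Sum>i<n. c i * kernel_operator k (g i) y) = 0"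
        by eventually_elim simp
    qed
  qed
  then have "(\<exists>g. (\<forall>i<n. g i \<in> L2 lborel) \<and>
      (\<forall>c. (AE y in lborel. (\<Sum>i<n. c i * kernel_operator k (g i) y) = 0) \<longrightarrow> (\<forall>i<n. c i = 0)))
    \<longleftrightarrow> (\<exists>g. (\<forall>i<n. g i \<in> L2 lborel) \<and>
      (\<forall>c. (AE y in lborel. (\<Sum>i<n. c i * kernel_operator k' (g i) y) = 0) \<longrightarrow> (\<forall>i<n. c i = 0)))" for n :: nat
    by blast
  then show ?thesis by (simp only: kernel_rank_def)
qed


section \<open>The kernel of the directional derivative\<close>

lemma hermite_beta_bounds:
  assumes "H \<in> {1/2<..<1}"
  shows "0 < hermite_beta H" "hermite_beta H < 1"
  using assms by (auto simp: hermite_beta_def hermite_alpha_def Let_def field_simps)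

lemma test_function:
  assumes "h \<in> test_functions"
  shows "continuous_on UNIV h" "{r. h r \<noteq> 0} \<subseteq> {0<..<1}" "\<exists>K. \<forall>r. \<bar>h r\<bar> \<le> K"
proof -
  have "\<And>n x. ((deriv ^^ n) h) differentiable (at x)"
    using assms by (auto simp: test_functions_def)
  from this[of 0] show cont: "continuous_on UNIV h"
    by (auto simp: continuous_on_eq_continuous_at intro: differentiable_imp_continuous_within)
  show *: "{r. h r \<noteq> 0} \<subseteq> {0<..<1}"
    using assms closure_subset[of "{x. h x \<noteq> 0}"] by (auto simp: test_functions_def)
  then have supp: "h r = 0" if "r \<notin> {0<..<1}" for r using that by blast
  have "compact (h ` {0..1})"
    by (intro compact_continuous_image continuous_on_subset[OF cont]) auto
  then obtain K where K: "\<And>y. y \<in> h ` {0..1} \<Longrightarrow> \<bar>y\<bar> \<le> K"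
    using compact_imp_bounded by (force simp: bounded_iff)
  have "\<bar>h r\<bar> \<le> K" for r
    using K[of "h r"] K[of "h 0"] supp[of r] by (cases "r \<in> {0<..<1}") auto
  then show "\<exists>K. \<forall>r. \<bar>h r\<bar> \<le> K" by blast
qed

lemma a_fun_eq_abel_transform:
  assumes "{r. h r \<noteq> 0} \<subseteq> {0<..<1}"
  shows "a_fun H h s = abel_transform (hermite_beta H) h s"
  unfolding a_fun_def abel_transform_def set_lebesgue_integral_def
proof (intro Bochner_Integration.integral_cong refl)
  fix r
  have "h r = 0" if "r \<le> 0" using assms that by force
  then show "indicator {0<..<s} r *\<^sub>R (h r * (s - r) powr - hermite_beta H) = h r * pos_power (hermite_beta H) (s - r)"
    by (cases "r \<le> 0") (auto simp: indicator_def pos_power_def)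
qed

text \<open>Where both factors are nonzero, the one whose singularity lies further to the left is at most
  \<open>\<bar>y - z\<bar>\<^bsup>-b\<^esup>\<close>. Thus off the diagonal the product is integrable in \<open>s\<close>, although \<open>2 b\<close> may exceed one.\<close>

lemma pos_power_product_le:
  assumes b: "0 < b" and "y \<noteq> z"
  shows "pos_power b (s - y) * pos_power b (s - z)
    \<le> pos_power b \<bar>y - z\<bar> * (pos_power b (s - y) + pos_power b (s - z))"
proof -
  have *: "pos_power b (s - y) * pos_power b (s - z) \<le> pos_power b (z - y) * pos_power b (s - z)"
    if "y < z" for y z
  proof (cases "z < s")
    case True
    then have "pos_power b (s - y) \<le> pos_power b (z - y)"
      using that b by (auto simp: pos_power_def intro!: powr_mono2')
    then show ?thesis by (rule mult_right_mono) simp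
  qed simp
  have nonneg: "0 \<le> pos_power b u * pos_power b v" for u v by simp
  show ?thesis
  proof (cases "y < z")
    case True
    then have eq: "\<bar>y - z\<bar> = z - y" by simp
    show ?thesis
      unfolding eq distrib_left using *[OF True] nonneg[of "z - y" "s - y"] by linarith
  next
    case False
    with \<open>y \<noteq> z\<close> have less: "z < y" by simp
    then have eq: "\<bar>y - z\<bar> = y - z" by simp
    show ?thesis
      unfolding eq distrib_left
      using *[OF less] nonneg[of "y - z" "s - z"] mult.commute[of "pos_power b (s - y)" "pos_power b (s - z)"]
      by linarith
  qed
qed

text \<open>Integrating the kernel of the Hermite variable against \<open>h\<close> in its last variable gives the
  kernel of the operator: Fubini moves the integral over \<open>r\<close> inside, where it becomes \<open>a\<^sub>h(s)\<close>.\<close>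

lemma f_kernel_mean:
  assumes b: "0 < hermite_beta H" "hermite_beta H < 1"
    and h [measurable]: "h \<in> borel_measurable borel" and hK: "\<And>r. \<bar>h r\<bar> \<le> K"
    and supp: "{r. h r \<noteq> 0} \<subseteq> {0<..<1}"
    and x: "x 0 \<noteq> x 1"
  shows "kernel2 (k_kernel H c h) x = (\<integral>r. h r * f_kernel H c (x(2 := r)) \<partial>lborel)"
proof -
  let ?b = "hermite_beta H"
  have h_le: "\<bar>h r\<bar> \<le> K * indicator {0..1} r" for r
    using hK[of r] supp by (cases "h r = 0") (auto simp: indicator_def)
  define w :: "real \<Rightarrow> real"
    where "w = (\<lambda>s. indicator {0..1} s * (pos_power ?b (s - x 0) * pos_power ?b (s - x 1)))"
  have [measurable]: "w \<in> borel_measurable borel" unfolding w_def by measurable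
  have w: "integrable lborel w"
  proof (rule Bochner_Integration.integrable_bound)
    have 1: "integrable lborel (\<lambda>s. indicator {0..1} s * pos_power ?b (s - t))" for t
      by (rule integrable_pos_power_weighted(2)[OF b, of _ 1]) auto
    show "integrable lborel (\<lambda>s. pos_power ?b \<bar>x 0 - x 1\<bar> *
        (indicator {0..1} s * pos_power ?b (s - x 0) + indicator {0..1} s * pos_power ?b (s - x 1)))"
      by (intro integrable_mult_right Bochner_Integration.integrable_add 1)
    show "AE s in lborel. norm (w s) \<le> norm (pos_power ?b \<bar>x 0 - x 1\<bar> *
        (indicator {0..1} s * pos_power ?b (s - x 0) + indicator {0..1} s * pos_power ?b (s - x 1)))"
      using pos_power_product_le[OF b(1) x] by (auto simp: w_def indicator_def)
  qed measurable
  have f: "f_kernel H c (x(2 := r)) = c * (\<integral>s. w s * pos_power ?b (s - r) \<partial>lborel)" for r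
  proof -
    have "{..<3::nat} = {0, 1, 2}" by auto
    then show ?thesis
      unfolding f_kernel_def set_lebesgue_integral_def w_def by (simp add: mult_ac)
  qed
  have "(\<integral>r. h r * f_kernel H c (x(2 := r)) \<partial>lborel)
      = c * (\<integral>r. h r * (\<integral>s. w s * pos_power ?b (s - r) \<partial>lborel) \<partial>lborel)"
    unfolding f by (subst mult.left_commute) simp
  also have "\<dots> = c * (\<integral>s. w s * abel_transform ?b h s \<partial>lborel)"
    unfolding abel_fubini(1)[OF b w h h_le] abel_transform_def ..
  also have "(\<integral>s. w s * abel_transform ?b h s \<partial>lborel)
      = (\<integral>s. indicator {0<..<1} s *\<^sub>R (a_fun H h s * pos_power ?b (s - x 0) * pos_power ?b (s - x 1)) \<partial>lborel)"
  proof (rule integral_cong_AE)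
    have [measurable]: "abel_transform ?b h \<in> borel_measurable borel"
      unfolding abel_transform_def[abs_def] by measurable
    show "(\<lambda>s. w s * abel_transform ?b h s) \<in> borel_measurable lborel"
      "(\<lambda>s. indicator {0<..<1} s *\<^sub>R (a_fun H h s * pos_power ?b (s - x 0) * pos_power ?b (s - x 1))) \<in> borel_measurable lborel"
      unfolding a_fun_eq_abel_transform[OF supp] by measurable
    show "AE s in lborel. w s * abel_transform ?b h s
        = indicator {0<..<1} s *\<^sub>R (a_fun H h s * pos_power ?b (s - x 0) * pos_power ?b (s - x 1))"
      using AE_lborel_singleton[of 0] AE_lborel_singleton[of 1]
      by eventually_elim (auto simp: w_def indicator_def a_fun_eq_abel_transform[OF supp])
  qed
  finally show ?thesis
    unfolding kernel2_def k_kernel_def set_lebesgue_integral_def by (rule sym)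
qed

lemma kernel2_k_kernel_measurable:
  assumes [measurable]: "h \<in> borel_measurable borel" and supp: "{r. h r \<noteq> 0} \<subseteq> {0<..<1}"
  shows "kernel2 (k_kernel H c h) \<in> borel_measurable (lebesgue_power 2)"
proof -
  have [measurable]: "abel_transform (hermite_beta H) h \<in> borel_measurable borel"
    unfolding abel_transform_def[abs_def] by measurable
  show ?thesis
    unfolding kernel2_def[abs_def] k_kernel_def set_lebesgue_integral_def a_fun_eq_abel_transform[OF supp]
    by measurable
qed

lemma kernel2_L2_sym:
  assumes "kernel2 k \<in> L2 (lebesgue_power 2)" "\<And>y z. k y z = k z y"
  shows "kernel2 k \<in> L2_sym 2"
proof -
  have "kernel2 k (x \<circ> p) = kernel2 k x" if p: "p permutes {..<2}" for p x
  proof -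
    have "p 0 \<in> {..<2}" "p 1 \<in> {..<2}" "p 0 \<noteq> p 1"
      using permutes_in_image[OF p, of 0] permutes_in_image[OF p, of 1] permutes_inj[OF p] by (auto dest: injD)
    then have "p 0 = 0 \<and> p 1 = 1 \<or> p 0 = 1 \<and> p 1 = 0" by auto
    then show ?thesis using assms(2) by (auto simp: kernel2_def)
  qed
  with assms(1) show ?thesis by (simp add: L2_sym_def)
qed

lemma k_kernel_sym: "k_kernel H c h y z = k_kernel H c h z y"
  by (simp add: k_kernel_def mult_ac)

text \<open>The density form keeps the Borel sets of the whole line, so that joint measurability on
  \<open>\<real> \<times> N\<close> carries over unchanged.\<close>

definition unit_uniform :: "real measure" where
  "unit_uniform = density lborel (\<lambda>r. ennreal (indicator {0..1} r))"

lemma unit_uniform: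
  fixes g :: "real \<Rightarrow> real"
  shows sets_unit_uniform [measurable_cong]: "sets unit_uniform = sets borel"
    and prob_space_unit_uniform: "prob_space unit_uniform"
    and AE_unit_uniform: "AE r in lborel. P r \<Longrightarrow> AE r in unit_uniform. P r"
    and integral_unit_uniform: "g \<in> borel_measurable borel \<Longrightarrow>
      (\<integral>r. g r \<partial>unit_uniform) = (LBINT r:{0..1}. g r)"
proof -
  show "sets unit_uniform = sets borel" by (simp add: unit_uniform_def)
  show "prob_space unit_uniform"
    by (rule prob_spaceI) (simp add: unit_uniform_def emeasure_density ennreal_indicator)
  show "AE r in lborel. P r \<Longrightarrow> AE r in unit_uniform. P r"
    unfolding unit_uniform_def by (subst AE_density) (auto elim: eventually_mono)
  show "g \<in> borel_measurable borel \<Longrightarrow> (\<integral>r. g r \<partial>unit_uniform) = (LBINT r:{0..1}. g r)"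
    unfolding unit_uniform_def set_lebesgue_integral_def by (subst integral_density) auto
qed

lemma L2_weighted_unit_uniform:
  assumes N: "sigma_finite_measure N" and G: "case_prod G \<in> L2 (lborel \<Otimes>\<^sub>M N)"
    and [measurable]: "h \<in> borel_measurable borel" and hK: "\<And>r. \<bar>h r\<bar> \<le> K"
  shows "(\<lambda>(r, x). h r * G r x) \<in> L2 (unit_uniform \<Otimes>\<^sub>M N)"
proof (rule L2_I)
  interpret N: sigma_finite_measure N by fact
  have [measurable]: "case_prod G \<in> borel_measurable (lborel \<Otimes>\<^sub>M N)" using G by (rule L2_measurable)
  have sets [measurable_cong]: "sets (unit_uniform \<Otimes>\<^sub>M N) = sets (lborel \<Otimes>\<^sub>M N)"
    by (intro sets_pair_measure_cong) (auto simp: sets_unit_uniform)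
  have G': "case_prod G \<in> borel_measurable (unit_uniform \<Otimes>\<^sub>M N)" by measurable
  then show meas [measurable]: "(\<lambda>(r, x). h r * G r x) \<in> borel_measurable (unit_uniform \<Otimes>\<^sub>M N)"
    by measurable
  show "integrable (unit_uniform \<Otimes>\<^sub>M N) (\<lambda>z. (case z of (r, x) \<Rightarrow> h r * G r x)\<^sup>2)"
  proof (rule integrableI_bounded)
    have "(\<integral>\<^sup>+z. ennreal (norm ((case z of (r, x) \<Rightarrow> h r * G r x)\<^sup>2)) \<partial>(unit_uniform \<Otimes>\<^sub>M N))
        = (\<integral>\<^sup>+r. \<integral>\<^sup>+x. ennreal ((h r * G r x)\<^sup>2) \<partial>N \<partial>unit_uniform)"
      by (subst N.nn_integral_fst[symmetric]) auto
    also have "\<dots> = (\<integral>\<^sup>+r. ennreal (indicator {0..1} r) * (\<integral>\<^sup>+x. ennreal ((h r * G r x)\<^sup>2) \<partial>N) \<partial>lborel)"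
      unfolding unit_uniform_def by (rule nn_integral_density) measurable
    also have "\<dots> \<le> (\<integral>\<^sup>+r. \<integral>\<^sup>+x. ennreal (K\<^sup>2) * ennreal ((G r x)\<^sup>2) \<partial>N \<partial>lborel)"
    proof (rule nn_integral_mono)
      fix r :: real
      have "ennreal ((h r * G r x)\<^sup>2) \<le> ennreal (K\<^sup>2) * ennreal ((G r x)\<^sup>2)" for x
      proof -
        have "(h r)\<^sup>2 \<le> K\<^sup>2" using power_mono[OF hK[of r], of 2] by simp
        then show ?thesis
          by (simp add: ennreal_mult[symmetric] power_mult_distrib mult_right_mono ennreal_leI)
      qed
      then have "(\<integral>\<^sup>+x. ennreal ((h r * G r x)\<^sup>2) \<partial>N) \<le> (\<integral>\<^sup>+x. ennreal (K\<^sup>2) * ennreal ((G r x)\<^sup>2) \<partial>N)"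
        by (rule nn_integral_mono)
      then show "ennreal (indicator {0..1} r) * (\<integral>\<^sup>+x. ennreal ((h r * G r x)\<^sup>2) \<partial>N)
          \<le> (\<integral>\<^sup>+x. ennreal (K\<^sup>2) * ennreal ((G r x)\<^sup>2) \<partial>N)"
        by (auto simp: indicator_def)
    qed
    also have "\<dots> = (\<integral>\<^sup>+z. ennreal (K\<^sup>2) * ennreal ((case_prod G z)\<^sup>2) \<partial>(lborel \<Otimes>\<^sub>M N))"
      by (subst N.nn_integral_fst[symmetric]) auto
    also have "\<dots> = ennreal (K\<^sup>2) * (\<integral>\<^sup>+z. ennreal ((case_prod G z)\<^sup>2) \<partial>(lborel \<Otimes>\<^sub>M N))"
      by (rule nn_integral_cmult) measurable
    also have "\<dots> < \<infinity>"
      using L2_integrable[OF G] by (simp add: integrable_iff_bounded ennreal_mult_less_top)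
    finally show "(\<integral>\<^sup>+z. ennreal (norm ((case z of (r, x) \<Rightarrow> h r * G r x)\<^sup>2)) \<partial>(unit_uniform \<Otimes>\<^sub>M N)) < \<infinity>" .
  qed measurable
qed

lemma L2_last_coordinate:
  assumes "f \<in> L2 (lebesgue_power (Suc q))"
  shows "(\<lambda>(r, x). f (x(q := r))) \<in> L2 (lborel \<Otimes>\<^sub>M lebesgue_power q)"
proof (rule L2_I)
  interpret Q: finite_product_sigma_finite "\<lambda>_::nat. lborel :: real measure" "{..<q}" by standard simp
  have f [measurable]: "f \<in> borel_measurable (lebesgue_power (Suc q))" using assms by (rule L2_measurable)
  have I: "{..<Suc q} = insert q {..<q}" by auto
  have T [measurable]: "(\<lambda>(r, x). x(q := r)) \<in> lborel \<Otimes>\<^sub>M lebesgue_power q \<rightarrow>\<^sub>M lebesgue_power (Suc q)"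
    using measurable_compose[OF measurable_pair_swap' measurable_add_dim[of q "{..<q}" "\<lambda>_. lborel"]]
    unfolding I by (simp add: case_prod_unfold)
  show meas: "(\<lambda>(r, x). f (x(q := r))) \<in> borel_measurable (lborel \<Otimes>\<^sub>M lebesgue_power q)"
    using measurable_compose[OF T f] by (simp add: case_prod_unfold)
  note [measurable] = meas
  show "integrable (lborel \<Otimes>\<^sub>M lebesgue_power q) (\<lambda>z. (case z of (r, x) \<Rightarrow> f (x(q := r)))\<^sup>2)"
  proof (rule integrableI_bounded)
    have "(\<integral>\<^sup>+z. ennreal (norm ((case z of (r, x) \<Rightarrow> f (x(q := r)))\<^sup>2)) \<partial>(lborel \<Otimes>\<^sub>M lebesgue_power q))
        = (\<integral>\<^sup>+r. \<integral>\<^sup>+x. ennreal ((f (x(q := r)))\<^sup>2) \<partial>lebesgue_power q \<partial>lborel)"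
      by (subst Q.nn_integral_fst[symmetric]) auto
    also have "\<dots> = (\<integral>\<^sup>+x. ennreal ((f x)\<^sup>2) \<partial>lebesgue_power (Suc q))"
      unfolding I using f by (intro lborel_power.product_nn_integral_insert_rev[symmetric]) (auto simp: I)
    also have "\<dots> < \<infinity>"
      using L2_integrable[OF assms] by (simp add: integrable_iff_bounded)
    finally show "(\<integral>\<^sup>+z. ennreal (norm ((case z of (r, x) \<Rightarrow> f (x(q := r)))\<^sup>2)) \<partial>(lborel \<Otimes>\<^sub>M lebesgue_power q)) < \<infinity>" .
  qed measurable
qed


section \<open>The directional derivative as a quadratic form\<close>

text \<open>The kernel \<open>k\<^sub>h\<close> and the variable \<open>D\<^sub>hF / 3\<close> together are the average over \<open>r\<close>,
  uniform on \<open>[0, 1]\<close>, of the pairs \<open>(h(r) f(\<sqdot>, r), h(r) D\<^sub>rF / 3)\<close>, which lie in the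
  graph of \<open>I\<^sub>2\<close> for almost every \<open>r\<close>.\<close>

theorem directional_derivative_wiener_integral:
  assumes iso: "isonormal M B" and H: "H \<in> {1/2<..<1}"
    and f: "f_kernel H c \<in> L2_sym 3"
    and DF: "malliavin_derivative M B 3 (f_kernel H c) DF"
    and h: "h \<in> test_functions"
  shows "wiener_integral M B 2 (kernel2 (k_kernel H c h)) (\<lambda>\<omega>. directional_derivative h DF \<omega> / 3)"
proof -
  interpret M: prob_space M using iso by (simp add: isonormal_def)
  interpret Q: finite_product_sigma_finite "\<lambda>_::nat. lborel :: real measure" "{..<2}" by standard simp
  note sM = M.sigma_finite_measure_axioms and sQ = Q.sigma_finite_measure_axioms
  note P = prob_space_unit_uniform
  note b = hermite_beta_bounds[OF H] and cont = test_function(1)[OF h] and supp = test_function(2)[OF h]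
  obtain K where hK: "\<And>r. \<bar>h r\<bar> \<le> K" using test_function(3)[OF h] by blast
  have h_meas [measurable]: "h \<in> borel_measurable borel" by (rule borel_measurable_continuous_onI[OF cont])
  have range: "0 \<le> r" "r \<le> 1" if "h r \<noteq> 0" for r
    using subsetD[OF supp, of r] that by auto
  define G where "G r x = f_kernel H c (x(2 := r))" for r x
  have GL: "case_prod G \<in> L2 (lborel \<Otimes>\<^sub>M lebesgue_power 2)"
    using L2_last_coordinate[of "f_kernel H c" 2] f by (simp add: L2_sym_def G_def[abs_def])
  have DFL: "case_prod DF \<in> L2 (lborel \<Otimes>\<^sub>M M)"
    using DF by (simp add: malliavin_derivative_def)
  have D3L: "case_prod (\<lambda>r \<omega>. 1 / 3 * DF r \<omega>) \<in> L2 (lborel \<Otimes>\<^sub>M M)"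
    using L2_cmult[OF DFL, of "1 / 3"] by (simp add: case_prod_unfold)
  have meas [measurable]: "case_prod G \<in> borel_measurable (lborel \<Otimes>\<^sub>M lebesgue_power 2)"
    "case_prod DF \<in> borel_measurable (lborel \<Otimes>\<^sub>M M)"
    using GL DFL by (auto dest: L2_measurable)
  have gL: "case_prod (\<lambda>r x. h r * G r x) \<in> L2 (unit_uniform \<Otimes>\<^sub>M lebesgue_power 2)"
    by (rule L2_weighted_unit_uniform[OF sQ GL h_meas hK])
  have ZL: "case_prod (\<lambda>r \<omega>. h r * (1 / 3 * DF r \<omega>)) \<in> L2 (unit_uniform \<Otimes>\<^sub>M M)"
    by (rule L2_weighted_unit_uniform[OF sM D3L h_meas hK])
  have "AE r in lborel. wiener_integral M B 2 (\<lambda>x. h r * G r x) (\<lambda>\<omega>. h r * (1 / 3 * DF r \<omega>))"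
  proof -
    have "AE r in lborel. \<exists>Y. wiener_integral M B 2 (G r) Y \<and> (AE \<omega> in M. DF r \<omega> = 3 * Y \<omega>)"
      using DF by (simp add: malliavin_derivative_def G_def[abs_def])
    then show ?thesis
    proof eventually_elim
      case (elim r)
      then obtain Y where Y: "wiener_integral M B 2 (G r) Y" "AE \<omega> in M. DF r \<omega> = 3 * Y \<omega>" by blast
      have "wiener_integral M B 2 (G r) (\<lambda>\<omega>. 1 / 3 * DF r \<omega>)"
      proof (rule wiener_integral_cong_AE[OF iso Y(1) wiener_integral_L2(1)[OF Y(1)]])
        show "(\<lambda>\<omega>. 1 / 3 * DF r \<omega>) \<in> borel_measurable M" by measurable
        show "AE \<omega> in M. 1 / 3 * DF r \<omega> = Y \<omega>" using Y(2) by eventually_elim simp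
      qed simp
      then show ?case by (rule wiener_integral_cmult)
    qed
  qed
  note wi = AE_unit_uniform[OF this]
  have mean: "AE x in lebesgue_power 2. kernel2 (k_kernel H c h) x = (\<integral>r. h r * G r x \<partial>unit_uniform)"
    using AE_off_diagonal AE_space
  proof eventually_elim
    case (elim x)
    then have "(\<lambda>r. h r * G r x) \<in> borel_measurable lborel" by measurable
    then have "(\<integral>r. h r * G r x \<partial>unit_uniform) = (LBINT r:{0..1}. h r * G r x)"
      by (intro integral_unit_uniform) simp
    also have "\<dots> = (\<integral>r. h r * G r x \<partial>lborel)"
      unfolding set_lebesgue_integral_def
      by (intro Bochner_Integration.integral_cong) (auto simp: indicator_def range)
    finally show ?case
      using f_kernel_mean[OF b h_meas hK supp elim(1)] by (simp add: G_def)
  qed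
  have "kernel2 (k_kernel H c h) \<in> L2 (lebesgue_power 2)"
    by (rule L2_cong_AE[OF mean_in_L2[OF P sQ gL] kernel2_k_kernel_measurable[OF h_meas supp]])
      (use mean in auto)
  then have "kernel2 (k_kernel H c h) \<in> L2_sym 2"
    by (rule kernel2_L2_sym) (rule k_kernel_sym)
  note avg = wiener_integral_mean[OF iso P gL ZL wi this mean]
  have X: "directional_derivative h DF \<in> borel_measurable M"
    unfolding directional_derivative_def[abs_def] set_lebesgue_integral_def by measurable
  show "wiener_integral M B 2 (kernel2 (k_kernel H c h)) (\<lambda>\<omega>. directional_derivative h DF \<omega> / 3)"
  proof (rule wiener_integral_cong_AE[OF iso avg wiener_integral_L2(1)[OF avg]])
    show "(\<lambda>\<omega>. directional_derivative h DF \<omega> / 3) \<in> borel_measurable M" using X by measurable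
    show "AE \<omega> in M. directional_derivative h DF \<omega> / 3 = (\<integral>r. h r * (1 / 3 * DF r \<omega>) \<partial>unit_uniform)"
      using AE_space
    proof eventually_elim
      case (elim \<omega>)
      then have "(\<lambda>r. h r * (1 / 3 * DF r \<omega>)) \<in> borel_measurable lborel" by measurable
      then have "(\<integral>r. h r * (1 / 3 * DF r \<omega>) \<partial>unit_uniform) = (LBINT r:{0..1}. h r * (1 / 3 * DF r \<omega>))"
        by (intro integral_unit_uniform) simp
      also have "\<dots> = (LBINT r:{0..1}. 1 / 3 * (h r * DF r \<omega>))"
        by (simp only: mult_ac)
      also have "\<dots> = 1 / 3 * (LBINT r:{0..1}. h r * DF r \<omega>)"
        by (rule set_integral_mult_right)
      finally show ?case by (simp add: directional_derivative_def)
    qed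
  qed simp
qed

lemma k_kernel_rank:
  assumes H: "H \<in> {1/2<..<1}" and c: "c \<noteq> 0" and h: "h \<in> test_functions" "h \<noteq> (\<lambda>_. 0)"
  shows "kernel_rank (k_kernel H c h) = \<infinity>"
proof -
  note b = hermite_beta_bounds[OF H] and cont = test_function(1)[OF h(1)] and supp = test_function(2)[OF h(1)]
  obtain K where hK: "\<And>r. \<bar>h r\<bar> \<le> K" using test_function(3)[OF h(1)] by blast
  have h_meas: "h \<in> borel_measurable borel" by (rule borel_measurable_continuous_onI[OF cont])
  have h_le: "\<bar>h r\<bar> \<le> K * indicator {0..1} r" for r
    using hK[of r] supp by (cases "h r = 0") (auto simp: indicator_def)
  have eq: "a_fun H h = abel_transform (hermite_beta H) h"
    using a_fun_eq_abel_transform[OF supp] by (rule ext)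
  obtain s0 where s0: "0 < s0" "s0 < 1" "a_fun H h s0 \<noteq> 0"
    using abel_transform_nonzero[OF b cont hK supp h(2)] unfolding eq by blast
  show ?thesis
  proof (rule abel_kernel_rank[where a="a_fun H h", OF b c _ _ s0])
    show "continuous_on {0<..<1} (a_fun H h)"
      unfolding eq by (rule abel_transform_continuous[OF b(2) cont hK supp])
    show "\<bar>a_fun H h s\<bar> \<le> K * abel_bound (hermite_beta H)" for s
      unfolding eq abel_transform_def by (rule integrable_pos_power_weighted(3)[OF b h_meas h_le])
  qed (simp add: k_kernel_def)
qed

text \<open>The kernel chosen in the definition of the rank of a quadratic form agrees with any other kernel
  of the form almost everywhere, and the rank does not see null sets.\<close>

lemma quadratic_form_rank_eq:
  assumes iso: "isonormal M B" and k: "wiener_integral M B 2 (kernel2 k) X"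
  shows "quadratic_form_rank M B X = kernel_rank k"
proof -
  define k' where "k' = (SOME k. wiener_integral M B 2 (kernel2 k) X)"
  have k': "wiener_integral M B 2 (kernel2 k') X"
    unfolding k'_def by (rule someI[where P="\<lambda>k. wiener_integral M B 2 (kernel2 k) X", OF k])
  have "kernel_rank k' = kernel_rank k"
    by (intro kernel_rank_cong_AE second_chaos_kernel_unique[OF iso k' k] L2_measurable
        wiener_integral_L2(2)[OF k'] wiener_integral_L2(2)[OF k])
  then show ?thesis by (simp add: quadratic_form_rank_def k'_def)
qed

theorem proposition3p4:
  fixes M :: "'a measure" and B :: "(real \<Rightarrow> real) \<Rightarrow> 'a \<Rightarrow> real"
    and F :: "'a \<Rightarrow> real" and DF :: "real \<Rightarrow> 'a \<Rightarrow> real"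
    and H c :: real and h :: "real \<Rightarrow> real"
  assumes "isonormal M B"
    and "H \<in> {1/2<..<1}"
    and "c > 0"
    and "wiener_integral M B 3 (f_kernel H c) F"
    and "(\<integral>\<omega>. (F \<omega>)\<^sup>2 \<partial>M) = 1"
    and "malliavin_derivative M B 3 (f_kernel H c) DF"
    and "h \<in> test_functions"
    and "h \<noteq> (\<lambda>_. 0)"
  shows "kernel_rank (k_kernel H c h) = \<infinity> \<and>
    (\<exists>Y. wiener_integral M B 2 (kernel2 (k_kernel H c h)) Y \<and>
       (AE \<omega> in M. directional_derivative h DF \<omega> = 3 * Y \<omega>)) \<and>
    quadratic_form_rank M B (directional_derivative h DF) = \<infinity>"
proof (intro conjI)
  show "kernel_rank (k_kernel H c h) = \<infinity>"
    using assms by (intro k_kernel_rank) auto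
  have wi: "wiener_integral M B 2 (kernel2 (k_kernel H c h)) (\<lambda>\<omega>. directional_derivative h DF \<omega> / 3)"
    by (rule directional_derivative_wiener_integral[OF assms(1,2) wiener_integral_L2(1)[OF assms(4)] assms(6,7)])
  then show "\<exists>Y. wiener_integral M B 2 (kernel2 (k_kernel H c h)) Y \<and>
      (AE \<omega> in M. directional_derivative h DF \<omega> = 3 * Y \<omega>)"
    by (intro exI[of _ "\<lambda>\<omega>. directional_derivative h DF \<omega> / 3"]) simp
  \<comment> \<open>The factor 3 is absorbed into the normalising constant, whose value the rank theorem leaves free.\<close>
  have "(\<lambda>x. 3 * kernel2 (k_kernel H c h) x) = kernel2 (k_kernel H (3 * c) h)"
    by (simp add: kernel2_def k_kernel_def fun_eq_iff)
  with wiener_integral_cmult[OF wi, of 3]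
  have "wiener_integral M B 2 (kernel2 (k_kernel H (3 * c) h)) (directional_derivative h DF)"
    by simp
  then have "quadratic_form_rank M B (directional_derivative h DF) = kernel_rank (k_kernel H (3 * c) h)"
    by (rule quadratic_form_rank_eq[OF assms(1)])
  also have "\<dots> = \<infinity>"
    using assms by (intro k_kernel_rank) auto
  finally show "quadratic_form_rank M B (directional_derivative h DF) = \<infinity>" .
qed

end
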